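(* If $A$ is a periodic abelian group, then $\mathrm{IAut}(A)$ is central-by-(locally finite), that is, $\mathrm{IAut}(A)$ has a central subgroup $Z$ such that $\mathrm{IAut}(A)/Z$ is locally finite.
   Context: Abelian groups $A$ are written additively; endomorphisms act on the right. An automorphism $\gamma$ of an abelian group $A$ is called inertial if $(H+H\gamma)/H$ is finite for each subgroup $H\le A$. $\mathrm{IAut}(A)$ denotes the subgroup of $\mathrm{Aut}(A)$ generated by all inertial automorphisms of $A$. *)

theory Defs
  imports "HOL-Algebra.Algebra"
begin

text \<open>Abelian groups are written multiplicatively, following the library: the sum of two
  subgroups is their set product, and \<open>H \<gamma>\<close> is the image of \<open>H\<close> under \<open>\<gamma>\<close>.\<close>

definition periodic_group :: "('a, 'b) monoid_scheme \<Rightarrow> bool" where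
  "periodic_group G \<longleftrightarrow> group G \<and> (\<forall>x \<in> carrier G. \<exists>n::nat. n > 0 \<and> x [^]\<^bsub>G\<^esub> n = \<one>\<^bsub>G\<^esub>)"

definition inertial_auto :: "('a, 'b) monoid_scheme \<Rightarrow> ('a \<Rightarrow> 'a) \<Rightarrow> bool" where
  "inertial_auto A \<gamma> \<longleftrightarrow> \<gamma> \<in> auto A \<and>
     (\<forall>H. subgroup H A \<longrightarrow> finite (carrier (A\<lparr>carrier := H <#>\<^bsub>A\<^esub> (\<gamma> ` H)\<rparr> Mod H)))"

text \<open>The library multiplies automorphisms by composing them as left operators. Composing them as
  right operators gives the opposite group, which has the same generated subgroups and the same
  central subgroups, and whose quotients are the opposites of the quotients here.\<close>

definition IAut :: "('a, 'b) monoid_scheme \<Rightarrow> ('a \<Rightarrow> 'a) monoid" where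
  "IAut A = subgroup_generated (AutoGroup A) {\<gamma>. inertial_auto A \<gamma>}"

definition group_center :: "('a, 'b) monoid_scheme \<Rightarrow> 'a set" where
  "group_center G = {z \<in> carrier G. \<forall>g \<in> carrier G. z \<otimes>\<^bsub>G\<^esub> g = g \<otimes>\<^bsub>G\<^esub> z}"

definition locally_finite_group :: "('a, 'b) monoid_scheme \<Rightarrow> bool" where
  "locally_finite_group G \<longleftrightarrow> group G \<and>
     (\<forall>S. finite S \<longrightarrow> S \<subseteq> carrier G \<longrightarrow> finite (carrier (subgroup_generated G S)))"

end

theory Submission
  imports Defs
begin

text \<open>The centre of the group of automorphisms generated by the inertial ones is shown to serve as \<open>Z\<close>.
  An automorphism \<open>u\<close> that acts on every \<open>A[p\<^sup>n] = {x. x^(p^n) = 1}\<close>, \<open>p\<close> prime, as raising to some power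
  commutes with every endomorphism, because an endomorphism maps \<open>A[p\<^sup>n]\<close> into itself and these
  subgroups generate \<open>A\<close> (\<open>prime_scalar_central\<close>). So it is enough to find, for each group
  \<open>\<Gamma>\<close> generated by finitely many inertial automorphisms, a \<open>\<Gamma>\<close>-invariant set \<open>E\<close> such that \<open>\<Gamma>\<close> induces only finitely many
  maps on \<open>E\<close> and such that each element of \<open>\<Gamma>\<close> fixing \<open>E\<close> pointwise is of that kind.

  All information on a single inertial \<open>\<gamma>\<close> comes from one fact, \<open>inertial_finite_subgroup\<close>: there is a finite
  subgroup \<open>T\<close> such that \<open>\<gamma> x \<in> \<langle>x\<rangle>T\<close> whenever \<open>\<langle>x\<rangle> \<inter> T = 1\<close>. Otherwise one picks
  \<open>x\<^sub>0, x\<^sub>1, \<dots>\<close> one after the other, each violating this for the subgroup generated by the previous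
  \<open>x\<^sub>i\<close> and \<open>\<gamma> x\<^sub>i\<close>, and for the subgroup \<open>H\<close> generated by all \<open>x\<^sub>i\<close> the cosets \<open>H \<gamma> x\<^sub>i\<close> are distinct.
  It has three consequences.

  \<^item> If \<open>p\<close> does not divide \<open>|T|\<close>, then \<open>\<gamma>\<close> is a power map on the \<open>p\<close>-part of \<open>A\<close>, hence raises the
    elements of each \<open>A[p\<^sup>n]\<close> to a common power (\<open>power_endo_scalar\<close>).

  \<^item> On \<open>A[p\<^sup>n]\<close>, \<open>\<gamma>\<close> agrees with raising to some power \<open>k\<close>, up to a factor in a finite subgroup, and exactly on a
    subgroup of finite index (\<open>inertial_almost_scalar\<close>). Therefore \<open>\<Gamma>\<close> induces a finite group on \<open>A[p\<^sup>n]\<close>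
    (\<open>finite_restrict_tors\<close>).

  \<^item> For every prime \<open>p\<close> there are \<open>N\<close> and a subgroup \<open>V\<close> of the \<open>p\<close>-part, trivial or with elements of order \<open>p^N\<close>, such that
    the \<open>p\<close>-part is \<open>V A[p\<^sup>N]\<close> and the generators of \<open>\<Gamma>\<close> act on each \<open>V \<inter> A[p\<^sup>n]\<close> as powers
    (\<open>inertial_prime_split\<close>). If for some \<open>n\<close> only finitely many elements of \<open>A[p]\<close> are \<open>p^n\<close>-th powers, then for large \<open>N\<close>
    the \<open>p^N\<close>-th powers in the \<open>p\<close>-part form a divisible group, which is \<open>V\<close>. If there are
    infinitely many for every \<open>n\<close>, then the exponents \<open>k\<close> for the various \<open>n\<close> are coherent, the deviation of \<open>\<gamma>\<close> from
    this \<open>p\<close>-adic power map has values in \<open>T\<close>, and \<open>V\<close> is the intersection of the kernels of the deviations.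

  Now let \<open>E\<close> be the union of the \<open>A[p\<^sup>N]\<close> over the finitely many primes not covered by the first
  consequence for some generator; for the other primes take \<open>N = 0\<close> and the whole \<open>p\<close>-part as \<open>V\<close>. If \<open>u \<in> \<Gamma>\<close> fixes
  \<open>A[p\<^sup>N]\<close> pointwise and acts on \<open>V \<inter> A[p\<^sup>n]\<close>, \<open>n \<ge> N\<close>, as the power \<open>k\<close>, then \<open>k \<equiv> 1\<close> modulo \<open>p^N\<close> unless
  \<open>V\<close> is trivial, so \<open>u\<close> is the power \<open>k\<close> on \<open>A[p\<^sup>N]\<close> too and thus on \<open>A[p\<^sup>n]\<close> (\<open>prime_split_scalar\<close>).\<close>

section \<open>Torsion abelian groups and inertial endomorphisms\<close>

text \<open>Torsion abelian groups, written multiplicatively.\<close>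

locale torsion_comm_group = comm_group G for G (structure) +
  assumes torsion: "x \<in> carrier G \<Longrightarrow> \<exists>n::nat. n > 0 \<and> x [^] n = \<one>"
begin

lemma ord_pos: "x \<in> carrier G \<Longrightarrow> ord x > 0"
  using torsion[of x] by (metis bot_nat_0.not_eq_extremum dvd_0_left_iff pow_eq_id)

lemma finite_powers:
  assumes "x \<in> carrier G"
  shows "finite (range (\<lambda>k::int. x [^] k))"
proof -
  have "x [^] k \<in> (\<lambda>k. x [^] k) ` {0..<int (ord x)}" for k :: int
  proof -
    have "x [^] k = x [^] (k mod int (ord x))"
      using assms by (simp add: int_pow_eq mod_eq_dvd_iff[symmetric])
    then show ?thesis using ord_pos[OF assms] by auto
  qed
  then have "range (\<lambda>k::int. x [^] k) \<subseteq> (\<lambda>k. x [^] k) ` {0..<int (ord x)}" by blast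
  then show ?thesis using finite_surj by blast
qed

lemma subgroup_powers:
  assumes "x \<in> carrier G"
  shows "subgroup (range (\<lambda>k::int. x [^] k)) G"
  using generate_is_subgroup[of "{x}"] assms generate_pow[OF assms]
  by (simp add: full_SetCompr_eq)

lemma subgroup_set_mult: "subgroup H G \<Longrightarrow> subgroup K G \<Longrightarrow> subgroup (H <#> K) G"
  using mult_subgroups by blast

lemma finite_set_mult: "finite H \<Longrightarrow> finite K \<Longrightarrow> finite (H <#> K)"
  by (simp add: set_mult_def)

lemma set_multI: "h \<in> H \<Longrightarrow> k \<in> K \<Longrightarrow> h \<otimes> k \<in> H <#> K"
  by (auto simp: set_mult_def)

lemma set_multE:
  assumes "x \<in> H <#> K" obtains h k where "h \<in> H" "k \<in> K" "x = h \<otimes> k"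
  using assms by (auto simp: set_mult_def)

lemma finite_subgroup_extend:
  assumes T: "subgroup T G" "finite T" and x: "x \<in> carrier G"
  shows "\<exists>T'. subgroup T' G \<and> finite T' \<and> T \<subseteq> T' \<and> x \<in> T'"
proof (intro exI conjI)
  let ?C = "range (\<lambda>k::int. x [^] k)"
  have C: "subgroup ?C G" "finite ?C" using subgroup_powers finite_powers x by auto
  show "subgroup (T <#> ?C) G" using subgroup_set_mult T C by blast
  show "finite (T <#> ?C)" using finite_set_mult T C by blast
  show "T \<subseteq> T <#> ?C"
    using set_multI[of _ T \<one> ?C] C(1) T(1) by (metis r_one subgroup.mem_carrier subgroup.one_closed subsetI)
  show "x \<in> T <#> ?C"
    using set_multI[of \<one> T x ?C] T(1) x by (metis int_pow_1 l_one rangeI subgroup.one_closed)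
qed

lemma right_divide_eq_iff:
  "\<lbrakk>x \<in> carrier G; y \<in> carrier G; z \<in> carrier G\<rbrakk> \<Longrightarrow> x \<otimes> inv y = z \<longleftrightarrow> x = z \<otimes> y"
  by (metis inv_solve_right m_closed inv_closed inv_solve_right')

text \<open>An injective endomorphism \<open>\<gamma>\<close> for which \<open>H (\<gamma> H) / H\<close> is finite for all subgroups \<open>H\<close>. Every element of
  \<open>H (\<gamma> H)\<close> is congruent modulo \<open>H\<close> to some \<open>\<gamma> x\<close> with \<open>x \<in> H\<close>, so the quotient is given by the cosets of these.\<close>

definition inertial :: "('a \<Rightarrow> 'a) \<Rightarrow> bool" where
  "inertial \<gamma> \<longleftrightarrow> \<gamma> \<in> hom G G \<and> inj_on \<gamma> (carrier G) \<and>
     (\<forall>H. subgroup H G \<longrightarrow> finite ((\<lambda>x. H #> \<gamma> x) ` H))"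

text \<open>The source of all restrictions on inertial endomorphisms: modulo a finite subgroup \<open>T\<close>, the cyclic subgroups
  that avoid \<open>T\<close> are preserved.\<close>

lemma inertial_finite_subgroup:
  assumes \<gamma>: "inertial \<gamma>"
  obtains T where "subgroup T G" "finite T"
    "\<And>x. \<lbrakk>x \<in> carrier G; \<And>k::int. x [^] k \<in> T \<Longrightarrow> x [^] k = \<one>\<rbrakk> \<Longrightarrow> \<exists>k::int. \<gamma> x \<otimes> inv (x [^] k) \<in> T"
proof (rule ccontr)
  assume con: "\<not> thesis"
  note ex = that
  have hom: "\<gamma> \<in> hom G G" using \<gamma> by (simp add: inertial_def)
  have cl: "\<gamma> x \<in> carrier G" if "x \<in> carrier G" for x using hom that by (simp add: hom_in_carrier)
  \<comment> \<open>The condition on \<open>x\<close> that \<open>T\<close> would have to exclude.\<close>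
  define good where "good T x \<longleftrightarrow> x \<in> carrier G \<and> (\<forall>k::int. x [^] k \<in> T \<longrightarrow> x [^] k = \<one>) \<and>
     (\<forall>k::int. \<gamma> x \<otimes> inv (x [^] k) \<notin> T)" for T x
  define nxt where "nxt T T' \<longleftrightarrow> subgroup T' G \<and> finite T' \<and> T \<subseteq> T' \<and> (\<exists>x. good T x \<and> x \<in> T' \<and> \<gamma> x \<in> T')" for T T'
  have "\<exists>T'. nxt T T'" if T: "subgroup T G" "finite T" for T
  proof -
    obtain x where x: "good T x" using con ex[OF T] unfolding good_def by metis
    then have xc: "x \<in> carrier G" by (simp add: good_def)
    obtain T1 where T1: "subgroup T1 G" "finite T1" "T \<subseteq> T1" "x \<in> T1"
      using finite_subgroup_extend[OF T xc] by blast
    obtain T2 where T2: "subgroup T2 G" "finite T2" "T1 \<subseteq> T2" "\<gamma> x \<in> T2"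
      using finite_subgroup_extend[OF T1(1,2) cl[OF xc]] by blast
    show ?thesis using T1 T2 x unfolding nxt_def by blast
  qed
  then have ex_nxt: "\<exists>T'. (subgroup T' G \<and> finite T') \<and> nxt T T'" if "subgroup T G \<and> finite T" for T
    using that unfolding nxt_def by meson
  have "\<exists>f. \<forall>n. (subgroup (f n) G \<and> finite (f n)) \<and> nxt (f n) (f (Suc n))"
    using triv_subgroup ex_nxt by (intro dependent_nat_choice) auto
  then obtain T where T: "\<And>n. subgroup (T n) G" "\<And>n. nxt (T n) (T (Suc n))" by blast
  obtain x where x: "\<And>n. good (T n) (x n)" "\<And>n. x n \<in> T (Suc n)" "\<And>n. \<gamma> (x n) \<in> T (Suc n)"
    using T(2) unfolding nxt_def by metis
  have xc: "x n \<in> carrier G" for n using x(1) by (simp add: good_def)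
  have Tmono: "T m \<subseteq> T n" if "m \<le> n" for m n
    using lift_Suc_mono_le[of T m n] T(2) that by (auto simp: nxt_def)
  define U where "U = rec_nat {\<one>} (\<lambda>n V. V <#> range (\<lambda>k::int. x n [^] k))"
  have U0: "U 0 = {\<one>}" and US: "\<And>n. U (Suc n) = U n <#> range (\<lambda>k::int. x n [^] k)"
    by (auto simp: U_def)
  have Usub: "subgroup (U n) G" for n
    by (induction n) (auto simp: U0 US triv_subgroup intro!: subgroup_set_mult subgroup_powers xc)
  have UT: "U n \<subseteq> T n" for n
  proof (induction n)
    case 0 show ?case using T(1) by (simp add: U0 subgroup.one_closed)
  next
    case (Suc n)
    show ?case
    proof
      fix y assume "y \<in> U (Suc n)"
      then obtain u k where u: "u \<in> U n" "y = u \<otimes> x n [^] (k::int)" unfolding US by (auto elim!: set_multE)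
      then have "u \<in> T (Suc n)" using Suc Tmono[of n "Suc n"] by auto
      moreover have "x n [^] k \<in> T (Suc n)" using subgroup_int_pow_closed[OF T(1) x(2)] .
      ultimately show "y \<in> T (Suc n)" using u subgroup.m_closed[OF T(1)] by blast
    qed
  qed
  have Uinc: "U n \<subseteq> U (Suc n)" for n
  proof
    fix u assume u: "u \<in> U n"
    then have "u = u \<otimes> x n [^] (0::int)" using Usub by (simp add: subgroup.mem_carrier[OF Usub])
    then show "u \<in> U (Suc n)" unfolding US using u by (metis rangeI set_multI)
  qed
  have Umono: "U m \<subseteq> U n" if "m \<le> n" for m n
    using lift_Suc_mono_le[of U m n] Uinc that by auto
  have xU: "x n \<in> U (Suc n)" for n
    unfolding US using set_multI[OF subgroup.one_closed[OF Usub] rangeI, of "\<lambda>k::int. x n [^] k" 1 n] xc by simp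
  \<comment> \<open>An element of \<open>T m\<close> generated by the \<open>x i\<close> is already generated by those with \<open>i < m\<close>.\<close>
  have cut: "U n \<inter> T m \<subseteq> U m" if "m \<le> n" for m n
    using that
  proof (induction n rule: dec_induct)
    case base show ?case by blast
  next
    case (step n)
    show ?case
    proof
      fix y assume y: "y \<in> U (Suc n) \<inter> T m"
      then obtain u k where u: "u \<in> U n" "y = u \<otimes> x n [^] (k::int)" unfolding US by (auto elim!: set_multE)
      have uT: "u \<in> T n" "y \<in> T n" using u(1) UT y Tmono[of m n] step(1) by auto
      then have "inv u \<otimes> y \<in> T n" using T(1) by (simp add: subgroup.m_closed subgroup.m_inv_closed)
      moreover have "inv u \<otimes> y = x n [^] k"
        using u(2) xc subgroup.mem_carrier[OF Usub u(1)] by (simp flip: m_assoc)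
      ultimately have "x n [^] k = \<one>" using x(1)[of n] by (simp add: good_def)
      then have "y = u" using u subgroup.mem_carrier[OF Usub u(1)] by simp
      then show "y \<in> U m" using step y u by blast
    qed
  qed
  define H where "H = (\<Union>n. U n)"
  have H: "subgroup H G"
  proof (rule subgroupI)
    show "H \<subseteq> carrier G" using subgroup.subset[OF Usub] by (auto simp: H_def)
    show "H \<noteq> {}" using subgroup.one_closed[OF Usub] by (auto simp: H_def)
    show "inv a \<in> H" if "a \<in> H" for a using that subgroup.m_inv_closed[OF Usub] by (auto simp: H_def)
    show "a \<otimes> b \<in> H" if ab: "a \<in> H" "b \<in> H" for a b
    proof -
      obtain m n where mn: "a \<in> U m" "b \<in> U n" using ab by (auto simp: H_def)
      then have "a \<in> U (max m n)" "b \<in> U (max m n)" using subsetD[OF Umono[of m "max m n"]] subsetD[OF Umono[of n "max m n"]] by simp_all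
      then show ?thesis using subgroup.m_closed[OF Usub] by (auto simp: H_def)
    qed
  qed
  have neq: "H #> \<gamma> (x i) \<noteq> H #> \<gamma> (x j)" if ij: "i < j" for i j
  proof
    assume "H #> \<gamma> (x i) = H #> \<gamma> (x j)"
    then have "\<gamma> (x j) \<in> H #> \<gamma> (x i)" using rcos_self[OF cl[OF xc] H, of j] by argo
    then obtain h where h: "h \<in> H" "\<gamma> (x j) = h \<otimes> \<gamma> (x i)" unfolding r_coset_def by blast
    have hc: "h \<in> carrier G" using subgroup.mem_carrier[OF H h(1)] .
    have gi: "\<gamma> (x i) \<in> T j" using x(3)[of i] Tmono[of "Suc i" j] ij by auto
    then have "\<gamma> (x i) \<in> T (Suc j)" using Tmono[of j "Suc j"] by auto
    then have "\<gamma> (x j) \<otimes> inv \<gamma> (x i) \<in> T (Suc j)"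
      using x(3)[of j] subgroup.m_closed[OF T(1)] subgroup.m_inv_closed[OF T(1)] by blast
    moreover have "\<gamma> (x j) \<otimes> inv \<gamma> (x i) = h"
      using right_divide_eq_iff[OF cl[OF xc] cl[OF xc] hc] h(2) by blast
    ultimately have hT: "h \<in> T (Suc j)" by argo
    obtain n where "h \<in> U n" using h(1) by (auto simp: H_def)
    then have "h \<in> U (Suc (max n j))" using subsetD[OF Umono[of n "Suc (max n j)"]] by simp
    then have "h \<in> U (Suc j)" using subsetD[OF cut[of "Suc j" "Suc (max n j)"]] hT by simp
    then obtain u k where u: "u \<in> U j" "h = u \<otimes> x j [^] (k::int)" unfolding US by (auto elim!: set_multE)
    have uc: "u \<in> carrier G" using subgroup.mem_carrier[OF Usub u(1)] .
    have "\<gamma> (x j) \<otimes> inv (x j [^] k) = u \<otimes> \<gamma> (x i)"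
      using h(2) u(2) uc xc[of j] cl[OF xc[of i]] cl[OF xc[of j]]
      by (subst right_divide_eq_iff) (simp_all only: int_pow_closed m_closed m_ac)
    also have "\<dots> \<in> T j" using UT u(1) gi subgroup.m_closed[OF T(1)] by blast
    finally show False using x(1)[of j] by (simp add: good_def)
  qed
  have "inj (\<lambda>n. H #> \<gamma> (x n))"
    by (rule linorder_injI) (use neq in auto)
  moreover have "range (\<lambda>n. H #> \<gamma> (x n)) \<subseteq> (\<lambda>x. H #> \<gamma> x) ` H"
    using xU by (auto simp: H_def)
  moreover have "finite ((\<lambda>x. H #> \<gamma> x) ` H)" using \<gamma> H by (simp add: inertial_def)
  ultimately show False using finite_subset range_inj_infinite by blast
qed

section \<open>Prime power torsion and power endomorphisms\<close>

text \<open>The elements killed by \<open>m\<close>, and the \<open>p\<close>-primary part. Primes are integers here, so that they can be used directly as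
  exponents next to arbitrary, possibly negative ones.\<close>

definition tors :: "int \<Rightarrow> 'a set" where
  "tors m = {x \<in> carrier G. x [^] m = \<one>}"

definition ppart :: "int \<Rightarrow> 'a set" where
  "ppart p = {x \<in> carrier G. \<exists>n::nat. x [^] (p ^ n) = \<one>}"

lemma int_pow_one_dvd: "\<lbrakk>x \<in> carrier G; x [^] (a::int) = \<one>; a dvd b\<rbrakk> \<Longrightarrow> x [^] b = \<one>"
  by (meson dvd_trans int_pow_eq_id)

lemma int_pow_one_coprime:
  assumes "x \<in> carrier G" "x [^] (a::int) = \<one>" "x [^] (b::int) = \<one>" "coprime a b"
  shows "x = \<one>"
proof -
  have "int (ord x) dvd 1" using assms by (metis int_pow_eq_id coprime_common_divisor)
  then have "x [^] (1::int) = \<one>" using assms int_pow_eq_id by blast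
  then show ?thesis using assms by simp
qed

lemma hom_ipow: "\<lbrakk>\<gamma> \<in> hom G G; x \<in> carrier G\<rbrakk> \<Longrightarrow> \<gamma> (x [^] (k::int)) = \<gamma> x [^] k"
  by (rule hom_int_pow[OF _ _ is_group is_group])

lemma subgroup_tors: "subgroup (tors m) G"
  by (rule subgroupI) (auto simp: tors_def int_pow_distrib int_pow_inv intro!: exI[of _ \<one>])

lemma tors_mono: "a dvd b \<Longrightarrow> tors a \<subseteq> tors b"
  unfolding tors_def using int_pow_one_dvd by blast

lemma tors_ppart: "tors (p ^ n) \<subseteq> ppart p"
  by (auto simp: tors_def ppart_def)

lemma ppart_common:
  assumes "x \<in> ppart p" "y \<in> ppart p"
  obtains n :: nat where "x \<in> tors (p ^ n)" "y \<in> tors (p ^ n)"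
proof -
  obtain m n :: nat where "x \<in> tors (p ^ m)" "y \<in> tors (p ^ n)"
    using assms by (auto simp: ppart_def tors_def)
  then have "x \<in> tors (p ^ (m + n))" "y \<in> tors (p ^ (m + n))"
    using tors_mono[of "p ^ m" "p ^ (m + n)"] tors_mono[of "p ^ n" "p ^ (m + n)"]
    by (auto simp: power_add)
  then show thesis using that by blast
qed

lemma subgroup_ppart: "subgroup (ppart p) G"
proof (rule subgroupI)
  show "ppart p \<subseteq> carrier G" by (auto simp: ppart_def)
  show "ppart p \<noteq> {}" by (auto simp: ppart_def intro!: exI[of _ \<one>])
  show "inv a \<in> ppart p" if "a \<in> ppart p" for a
    using that by (auto simp: ppart_def int_pow_inv)
  show "a \<otimes> b \<in> ppart p" if ab: "a \<in> ppart p" "b \<in> ppart p" for a b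
  proof -
    obtain n :: nat where "a \<in> tors (p ^ n)" "b \<in> tors (p ^ n)" using ppart_common[OF ab] .
    then have "a \<otimes> b \<in> tors (p ^ n)" using subgroup.m_closed[OF subgroup_tors] by blast
    then show ?thesis using tors_ppart by blast
  qed
qed

text \<open>The order of \<open>x\<close> modulo \<open>T\<close> is a power of \<open>p\<close>, and it is at least \<open>p^m\<close>.\<close>

lemma prime_power_exponent_least:
  fixes p :: int
  assumes p: "Factorial_Ring.prime p" and T: "subgroup T G" and x: "x \<in> carrier G"
    and N: "x [^] (p ^ N) \<in> T" and least: "\<And>i. i < m \<Longrightarrow> x [^] (p ^ i) \<notin> T"
    and k: "x [^] (k::int) \<in> T"
  shows "p ^ m dvd k"
proof -
  let ?d = "gcd k (p ^ N)"
  obtain a b where ab: "a * k + b * p ^ N = ?d" using bezout_int by blast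
  have "x [^] ?d = (x [^] k) [^] a \<otimes> (x [^] (p ^ N)) [^] b"
    using x by (simp add: int_pow_pow mult.commute flip: ab int_pow_mult)
  also have "\<dots> \<in> T" using T N k by (simp add: subgroup.m_closed subgroup_int_pow_closed)
  finally have d: "x [^] ?d \<in> T" .
  obtain s where s: "s \<le> N" "?d = p ^ s"
    using divides_primepow[OF p, of ?d N] by auto
  then have "m \<le> s" using d least by (metis not_less)
  then have "p ^ m dvd ?d" using s by (simp add: le_imp_power_dvd)
  then show ?thesis by auto
qed

lemma prime_power_order:
  fixes p :: int
  assumes p: "Factorial_Ring.prime p" and x: "x \<in> carrier G" "x [^] (p ^ Suc n) = \<one>" "x [^] (p ^ n) \<noteq> \<one>"
    and k: "x [^] (k::int) = \<one>"
  shows "p ^ Suc n dvd k"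
proof (rule prime_power_exponent_least[OF p triv_subgroup x(1), of "Suc n"])
  show "x [^] (p ^ i) \<notin> {\<one>}" if "i < Suc n" for i
    using x that int_pow_one_dvd[OF x(1), of "p ^ i" "p ^ n"] by (auto simp: le_imp_power_dvd)
qed (use assms in auto)

text \<open>A cyclic \<open>p\<close>-group has only one subgroup of order \<open>p\<close>, so it avoids \<open>T\<close> as soon as that subgroup does.\<close>

lemma powers_meet_trivial:
  fixes p :: int
  assumes p: "Factorial_Ring.prime p" and T: "subgroup T G" and x: "x \<in> carrier G" "x [^] (p ^ Suc n) = \<one>" "x [^] (p ^ n) \<notin> T"
    and k: "x [^] (k::int) \<in> T"
  shows "x [^] k = \<one>"
proof -
  have "p ^ Suc n dvd k"
  proof (rule prime_power_exponent_least[OF p T x(1) _ _ k])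
    show "x [^] (p ^ Suc n) \<in> T" using x T by (simp add: subgroup.one_closed)
    show "x [^] (p ^ i) \<notin> T" if i: "i < Suc n" for i
    proof
      assume "x [^] (p ^ i) \<in> T"
      then have "(x [^] (p ^ i)) [^] (p ^ (n - i)) \<in> T" by (rule subgroup_int_pow_closed[OF T])
      then show False using x i by (simp add: int_pow_pow flip: power_add)
    qed
  qed
  then show ?thesis using int_pow_one_dvd x by blast
qed

lemma ppart_last_power:
  fixes p :: int
  assumes "x \<in> ppart p" "x \<noteq> \<one>"
  obtains n :: nat where "x [^] (p ^ Suc n) = \<one>" "x [^] (p ^ n) \<noteq> \<one>"
proof -
  have x: "x \<in> carrier G" using assms by (simp add: ppart_def)
  define n where "n = (LEAST n. x [^] (p ^ n) = \<one>)"
  have n: "x [^] (p ^ n) = \<one>"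
    unfolding n_def by (rule LeastI_ex) (use assms in \<open>auto simp: ppart_def\<close>)
  then have "n \<noteq> 0" using assms x by (metis int_pow_1 power_0)
  then obtain m where "n = Suc m" using not0_implies_Suc by blast
  moreover have "x [^] (p ^ m) \<noteq> \<one>" if "m < n" for m
    using that not_less_Least unfolding n_def by blast
  ultimately show thesis using that n by blast
qed

text \<open>An endomorphism preserving all cyclic subgroups of \<open>V\<close> raises all elements of \<open>V\<close> of bounded \<open>p\<close>-power order to the same
  power, namely to the one that belongs to an element \<open>x\<close> of maximal order. For another element \<open>w\<close>, a suitable
  \<open>w' \<in> w\<langle>x\<rangle>\<close> generates a complement of \<open>\<langle>x\<rangle>\<close>, and the powers on \<open>x\<close>, \<open>w'\<close> and \<open>x w'\<close> are compared.\<close>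

lemma power_endo_scalar:
  fixes p :: int
  assumes p: "Factorial_Ring.prime p" and V: "subgroup V G" and \<gamma>: "\<gamma> \<in> hom G G"
    and pow: "\<And>z. z \<in> V \<Longrightarrow> \<exists>k::int. \<gamma> z = z [^] k"
  shows "\<exists>k::int. \<forall>x \<in> V \<inter> tors (p ^ n). \<gamma> x = x [^] k"
proof -
  define M where "M = V \<inter> tors (p ^ n)"
  have MX: "x \<in> V" "x \<in> carrier G" if "x \<in> M" for x
    using that subgroup.mem_carrier[OF V] unfolding M_def by blast+
  define e where "e = (LEAST e. \<forall>x\<in>M. x [^] (p ^ e) = \<one>)"
  have e: "\<forall>x\<in>M. x [^] (p ^ e) = \<one>"
    unfolding e_def by (rule LeastI_ex) (auto simp: M_def tors_def)
  show ?thesis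
  proof (cases e)
    case 0
    then have "x = \<one>" if "x \<in> M" for x using that e MX by (metis int_pow_1 power_0)
    moreover have "\<gamma> \<one> = \<one>" using hom_one[OF \<gamma> is_group is_group] .
    ultimately show ?thesis unfolding M_def[symmetric] by (intro exI[of _ 0]) auto
  next
    case (Suc m)
    then have "\<not> (\<forall>x\<in>M. x [^] (p ^ m) = \<one>)" 
      using not_less_Least[of m "\<lambda>e. \<forall>x\<in>M. x [^] (p ^ e) = \<one>"] unfolding e_def by auto
    then obtain x where x: "x \<in> M" "x [^] (p ^ m) \<noteq> \<one>" by blast
    note xc = MX(2)[OF x(1)]
    have xe: "x [^] (p ^ Suc m) = \<one>" using e x Suc by auto
    have xdvd: "p ^ e dvd k" if "x [^] (k::int) = \<one>" for k
      using prime_power_order[OF p xc xe x(2) that] Suc by simp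
    obtain k where k: "\<gamma> x = x [^] (k::int)" using pow MX x by blast
    let ?T = "range (\<lambda>i::int. x [^] i)"
    note T = subgroup_powers[OF xc]
    have "\<gamma> w = w [^] k" if w: "w \<in> M" for w
    proof -
      note wc = MX(2)[OF w]
      define s where "s = (LEAST s. w [^] (p ^ s) \<in> ?T)"
      have we: "w [^] (p ^ e) \<in> ?T" using e w subgroup.one_closed[OF T] by simp
      have s: "w [^] (p ^ s) \<in> ?T" unfolding s_def using we by (rule LeastI)
      have se: "s \<le> e" unfolding s_def using we by (rule Least_le)
      have least: "w [^] (p ^ i) \<notin> ?T" if "i < s" for i
        using not_less_Least[OF that[unfolded s_def]] .
      have sdvd: "p ^ s dvd i" if "w [^] (i::int) \<in> ?T" for i
        by (rule prime_power_exponent_least[OF p T wc s least that])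
      obtain j where j: "w [^] (p ^ s) = x [^] (j::int)" using s by blast
      have "x [^] (j * p ^ (e - s)) = (w [^] (p ^ s)) [^] (p ^ (e - s))"
        using xc j by (simp add: int_pow_pow)
      also have "\<dots> = \<one>" using wc se e w by (simp add: int_pow_pow flip: power_add)
      finally have "p ^ s * p ^ (e - s) dvd j * p ^ (e - s)" using xdvd se by (simp flip: power_add)
      then have "p ^ s dvd j" using p by (simp add: prime_gt_0_int)
      then obtain u where u: "j = p ^ s * u" by blast
      define w' where "w' = w \<otimes> x [^] (- u)"
      have w'c: "w' \<in> carrier G" using wc xc by (simp add: w'_def)
      have w'V: "w' \<in> V"
        using MX(1)[OF w] MX(1)[OF x(1)] subgroup.m_closed[OF V] subgroup_int_pow_closed[OF V] unfolding w'_def by blast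
      have w'pow: "w' [^] i = w [^] i \<otimes> x [^] (- u * i)" for i :: int
        using wc xc by (simp add: w'_def int_pow_distrib int_pow_pow)
      have w's: "w' [^] (p ^ s) = \<one>"
        using w'pow[of "p ^ s"] j u xc by (simp add: int_pow_mult[symmetric] algebra_simps)
      have w'T: "w' [^] i = \<one>" if i: "w' [^] (i::int) \<in> ?T" for i
      proof -
        have "w [^] i = w' [^] i \<otimes> x [^] (u * i)"
          unfolding w'pow using wc xc by (simp add: m_assoc int_pow_mult[symmetric])
        also have "\<dots> \<in> ?T" using i subgroup.m_closed[OF T] by blast
        finally show ?thesis using sdvd int_pow_one_dvd[OF w'c w's] by blast
      qed
      obtain l where l: "\<gamma> (x \<otimes> w') = (x \<otimes> w') [^] (l::int)"
        using pow w'V MX(1)[OF x(1)] subgroup.m_closed[OF V] by blast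
      obtain m' where m': "\<gamma> w' = w' [^] (m'::int)" using pow w'V by blast
      have eq: "x [^] k \<otimes> w' [^] m' = x [^] l \<otimes> w' [^] l"
        using l k m' hom_mult[OF \<gamma> xc w'c] xc w'c by (simp add: int_pow_distrib)
      have "x [^] (k - l) = w' [^] (l - m')"
      proof -
        have "x [^] (k - l) \<otimes> (x [^] l \<otimes> w' [^] m') = w' [^] (l - m') \<otimes> (x [^] l \<otimes> w' [^] m')"
        proof -
          have "x [^] (k - l) \<otimes> (x [^] l \<otimes> w' [^] m') = x [^] k \<otimes> w' [^] m'"
            using xc w'c by (simp add: m_assoc[symmetric] int_pow_mult[symmetric])
          also have "\<dots> = x [^] l \<otimes> (w' [^] (l - m') \<otimes> w' [^] m')"
            using eq w'c by (simp add: int_pow_mult[symmetric])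
          also have "\<dots> = w' [^] (l - m') \<otimes> (x [^] l \<otimes> w' [^] m')"
            using xc w'c by (simp add: m_ac)
          finally show ?thesis .
        qed
        then show ?thesis using xc w'c by simp
      qed
      then have wl: "w' [^] (l - m') = \<one>" "x [^] (k - l) = \<one>"
        using w'T by (metis rangeI)+
      have "w' [^] (p ^ e) = \<one>" using int_pow_one_dvd[OF w'c w's] se by (simp add: le_imp_power_dvd)
      then have "w' [^] (k - l) = \<one>" using xdvd[OF wl(2)] int_pow_one_dvd[OF w'c] by blast
      then have "w' [^] ((k - l) + (l - m')) = \<one>" using wl w'c by (simp only: int_pow_mult l_one one_closed)
      then have "w' [^] m' = w' [^] k" using w'c by (simp add: int_pow_diff right_divide_eq_iff)
      moreover have w: "w = w' \<otimes> x [^] u"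
        using wc xc by (simp add: w'_def m_assoc int_pow_mult[symmetric])
      ultimately show ?thesis
        using k m' xc w'c hom_mult[OF \<gamma>] by (simp add: hom_ipow[OF \<gamma>] int_pow_distrib int_pow_pow mult.commute)
    qed
    then show ?thesis unfolding M_def by blast
  qed
qed

section \<open>Subgroups of finite index\<close>

text \<open>\<open>E\<close> is covered by finitely many cosets of \<open>B\<close> with representatives in \<open>E\<close>. It is not required that \<open>B \<subseteq> E\<close>.\<close>

definition fin_idx :: "'a set \<Rightarrow> 'a set \<Rightarrow> bool" where
  "fin_idx B E \<longleftrightarrow> (\<exists>R. finite R \<and> R \<subseteq> E \<and> (\<forall>x\<in>E. \<exists>r\<in>R. x \<otimes> inv r \<in> B))"

lemma fin_idxI:
  assumes "finite (f ` E)" "\<And>x y. \<lbrakk>x \<in> E; y \<in> E; f x = f y\<rbrakk> \<Longrightarrow> x \<otimes> inv y \<in> B"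
  shows "fin_idx B E"
proof -
  have "inv_into E f ` (f ` E) \<subseteq> E" by (auto intro: inv_into_into)
  moreover have "\<exists>r\<in>inv_into E f ` (f ` E). x \<otimes> inv r \<in> B" if "x \<in> E" for x
    using that assms(2)[OF that, of "inv_into E f (f x)"] by (auto simp: f_inv_into_f inv_into_into)
  ultimately show ?thesis unfolding fin_idx_def using assms(1) by blast
qed

lemma fin_idx_Int:
  assumes B: "subgroup B G" "fin_idx B E" and C: "subgroup C G" "fin_idx C E" and E: "E \<subseteq> carrier G"
  shows "fin_idx (B \<inter> C) E"
proof -
  obtain R S where R: "finite R" "R \<subseteq> E" "\<And>x. x \<in> E \<Longrightarrow> \<exists>r\<in>R. x \<otimes> inv r \<in> B"
    and S: "finite S" "S \<subseteq> E" "\<And>x. x \<in> E \<Longrightarrow> \<exists>r\<in>S. x \<otimes> inv r \<in> C"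
    using assms unfolding fin_idx_def by metis
  obtain f g where f: "\<And>x. x \<in> E \<Longrightarrow> f x \<in> R \<and> x \<otimes> inv (f x) \<in> B"
    and g: "\<And>x. x \<in> E \<Longrightarrow> g x \<in> S \<and> x \<otimes> inv (g x) \<in> C" using R(3) S(3) by metis
  have *: "x \<otimes> inv y \<in> K" if "subgroup K G" "x \<in> carrier G" "y \<in> carrier G" "r \<in> carrier G"
    "x \<otimes> inv r \<in> K" "y \<otimes> inv r \<in> K" for x y r K
  proof -
    have "(x \<otimes> inv r) \<otimes> inv (y \<otimes> inv r) \<in> K" using that by (simp add: subgroup.m_closed subgroup.m_inv_closed)
    moreover have "(x \<otimes> inv r) \<otimes> inv (y \<otimes> inv r) = x \<otimes> (inv r \<otimes> r) \<otimes> inv y"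
      using that(2-4) by (simp only: inv_mult inv_closed inv_inv m_ac m_closed)
    ultimately show ?thesis using that(2-4) by simp
  qed
  show ?thesis
  proof (rule fin_idxI[of "\<lambda>x. (f x, g x)"])
    have "(\<lambda>x. (f x, g x)) ` E \<subseteq> R \<times> S" using f g by auto
    then show "finite ((\<lambda>x. (f x, g x)) ` E)" using R S by (meson finite_SigmaI finite_subset)
    show "x \<otimes> inv y \<in> B \<inter> C" if xy: "x \<in> E" "y \<in> E" "(f x, g x) = (f y, g y)" for x y
      using *[OF B(1), of x y "f x"] *[OF C(1), of x y "g x"] f[of x] f[of y] g[of x] g[of y] xy E R(2) S(2)
      by (auto simp: subset_iff)
  qed
qed

text \<open>A bounded abelian \<open>p\<close>-group \<open>E\<close> is residually finite. If the subgroup \<open>B\<close> is maximal with \<open>B \<inter> T = 1\<close>, then \<open>T\<close> covers the elements of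
  order \<open>p\<close> in \<open>E / B\<close>, and a bounded \<open>p\<close>-group with only finitely many elements of order \<open>p\<close> is finite.\<close>

lemma fin_idx_avoiding:
  fixes p :: int
  assumes p: "Factorial_Ring.prime p" and T: "subgroup T G" "finite T"
  shows "\<exists>B. subgroup B G \<and> B \<subseteq> tors (p ^ N) \<and> fin_idx B (tors (p ^ N)) \<and> B \<inter> T = {\<one>}"
proof -
  define E where "E = tors (p ^ N)"
  have E: "subgroup E G" unfolding E_def by (rule subgroup_tors)
  define \<A> where "\<A> = {B. subgroup B G \<and> B \<subseteq> E \<and> B \<inter> T = {\<one>}}"
  have "\<exists>B\<in>\<A>. \<forall>V\<in>\<A>. B \<subseteq> V \<longrightarrow> V = B"
  proof (rule subset_Zorn_nonempty)
    show "\<A> \<noteq> {}" using triv_subgroup subgroup.one_closed[OF E] subgroup.one_closed[OF T(1)] by (auto simp: \<A>_def intro!: exI[of _ "{\<one>}"])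
    show "\<Union>C \<in> \<A>" if C: "C \<noteq> {}" "subset.chain \<A> C" for C
    proof -
      have CA: "B \<in> \<A>" if "B \<in> C" for B using that C(2) by (auto simp: subset_chain_def)
      have sub: "subgroup B G" if "B \<in> C" for B using CA[OF that] by (simp add: \<A>_def)
      have "subgroup (\<Union>C) G"
      proof (rule subgroupI)
        show "\<Union>C \<subseteq> carrier G" using subgroup.subset[OF sub] by blast
        show "\<Union>C \<noteq> {}" using subgroup.one_closed[OF sub] C(1) by blast
        show "inv a \<in> \<Union>C" if "a \<in> \<Union>C" for a using that subgroup.m_inv_closed[OF sub] by blast
        show "a \<otimes> b \<in> \<Union>C" if ab: "a \<in> \<Union>C" "b \<in> \<Union>C" for a b
        proof -
          obtain A B where AB: "A \<in> C" "a \<in> A" "B \<in> C" "b \<in> B" using ab by blast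
          then have "A \<subseteq> B \<or> B \<subseteq> A" using C(2) by (auto simp: subset_chain_def)
          then show ?thesis using AB subgroup.m_closed[OF sub] by blast
        qed
      qed
      then show ?thesis using CA C(1) by (fastforce simp: \<A>_def)
    qed
  qed
  then obtain B where B: "subgroup B G" "B \<subseteq> E" "B \<inter> T = {\<one>}"
    and max: "\<And>V. \<lbrakk>subgroup V G; V \<subseteq> E; V \<inter> T = {\<one>}; B \<subseteq> V\<rbrakk> \<Longrightarrow> V = B"
    unfolding \<A>_def by auto
  have Bc: "b \<in> carrier G" if "b \<in> B" for b using that subgroup.mem_carrier[OF B(1)] by blast
  have Ec: "b \<in> carrier G" if "b \<in> E" for b using that subgroup.mem_carrier[OF E] by blast
  have Tc: "b \<in> carrier G" if "b \<in> T" for b using that subgroup.mem_carrier[OF T(1)] by blast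
  \<comment> \<open>The elements of order \<open>p\<close> in \<open>E / B\<close> are covered by \<open>T\<close>.\<close>
  have socle: "\<exists>t\<in>T. y \<otimes> inv t \<in> B" if y: "y \<in> E" "y [^] p \<in> B" for y
  proof (cases "y \<in> B")
    case True
    then show ?thesis using T Bc by (intro bexI[of _ \<one>]) (auto simp: subgroup.one_closed)
  next
    case False
    note yc = Ec[OF y(1)]
    let ?Y = "range (\<lambda>k::int. y [^] k)"
    have sub: "subgroup (B <#> ?Y) G" using subgroup_set_mult[OF B(1) subgroup_powers[OF yc]] .
    have "B <#> ?Y \<subseteq> E"
      using B(2) subgroup_int_pow_closed[OF E y(1)] subgroup.m_closed[OF E] by (auto elim!: set_multE)
    moreover have BY: "B \<subseteq> B <#> ?Y"
    proof
      fix b assume "b \<in> B"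
      then have "b \<otimes> y [^] (0::int) \<in> B <#> ?Y" by (intro set_multI rangeI)
      then show "b \<in> B <#> ?Y" using Bc[OF \<open>b \<in> B\<close>] by simp
    qed
    moreover have "y \<in> B <#> ?Y"
    proof -
      have "\<one> \<otimes> y [^] (1::int) \<in> B <#> ?Y" using subgroup.one_closed[OF B(1)] by (intro set_multI rangeI)
      then show ?thesis using yc by simp
    qed
    ultimately have "(B <#> ?Y) \<inter> T \<noteq> {\<one>}" using max[OF sub] False by auto
    moreover have "\<one> \<in> (B <#> ?Y) \<inter> T" using subgroup.one_closed[OF sub] subgroup.one_closed[OF T(1)] by auto
    ultimately obtain t where t: "t \<in> T" "t \<in> B <#> ?Y" "t \<noteq> \<one>" by blast
    then obtain b j where b: "b \<in> B" "t = b \<otimes> y [^] (j::int)" by (auto elim!: set_multE)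
    note bc = Bc[OF b(1)]
    have "\<not> p dvd j"
    proof
      assume "p dvd j"
      then obtain i where "j = p * i" by blast
      then have "y [^] j = (y [^] p) [^] i" using yc by (simp add: int_pow_pow)
      then have "y [^] j \<in> B" using subgroup_int_pow_closed[OF B(1) y(2)] by simp
      then have "t \<in> B" using b subgroup.m_closed[OF B(1)] by simp
      then show False using B t by auto
    qed
    then have "coprime p j" using p prime_imp_coprime by blast
    then obtain a c where ac: "a * p + c * j = 1" using bezout_int[of p j] by auto
    have "y = y [^] (a * p + c * j)" using ac yc by simp
    also have "\<dots> = (y [^] p) [^] a \<otimes> (y [^] j) [^] c"
      using yc by (simp add: int_pow_mult int_pow_pow mult.commute)
    also have "y [^] j = inv b \<otimes> t" using b(2) bc yc by (simp add: m_assoc[symmetric])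
    finally have y': "y = (y [^] p) [^] a \<otimes> (inv b [^] c \<otimes> t [^] c)"
      using bc Tc[OF t(1)] by (simp add: int_pow_distrib)
    have "y \<otimes> inv (t [^] c) = (y [^] p) [^] a \<otimes> inv b [^] c"
      by (subst y') (use bc yc Tc[OF t(1)] in \<open>simp add: m_assoc\<close>)
    also have "\<dots> \<in> B" 
      by (intro subgroup.m_closed[OF B(1)] subgroup_int_pow_closed[OF B(1)] subgroup.m_inv_closed[OF B(1)] y(2) b(1))
    finally show ?thesis using subgroup_int_pow_closed[OF T(1) t(1)] by blast
  qed
  \<comment> \<open>By induction on \<open>k\<close>, the elements of \<open>E / B\<close> killed by \<open>p^k\<close> are finite in number.\<close>
  have "\<exists>R. finite R \<and> R \<subseteq> carrier G \<and> (\<forall>y\<in>E. y [^] (p ^ k) \<in> B \<longrightarrow> (\<exists>r\<in>R. y \<otimes> inv r \<in> B))" for k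
  proof (induction k)
    case 0
    then show ?case using Ec by (intro exI[of _ "{\<one>}"]) auto
  next
    case (Suc k)
    then obtain R where R: "finite R" "R \<subseteq> carrier G" "\<And>y. \<lbrakk>y \<in> E; y [^] (p ^ k) \<in> B\<rbrakk> \<Longrightarrow> \<exists>r\<in>R. y \<otimes> inv r \<in> B"
      by blast
    define R' where "R' = {r \<in> R. \<exists>y\<in>E. y [^] p \<otimes> inv r \<in> B}"
    have "\<forall>r\<in>R'. \<exists>y. y \<in> E \<and> y [^] p \<otimes> inv r \<in> B" unfolding R'_def by blast
    from bchoice[OF this] obtain f where f: "\<And>r. r \<in> R' \<Longrightarrow> f r \<in> E \<and> f r [^] p \<otimes> inv r \<in> B"
      by blast
    have "finite (f ` R' <#> T)" using R T by (intro finite_set_mult) (auto simp: R'_def)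
    moreover have "f ` R' <#> T \<subseteq> carrier G" using f Ec Tc by (auto elim!: set_multE)
    moreover have "\<exists>r\<in>f ` R' <#> T. y \<otimes> inv r \<in> B" if y: "y \<in> E" "y [^] (p ^ Suc k) \<in> B" for y
    proof -
      note yc = Ec[OF y(1)]
      have "y [^] p \<in> E" using subgroup_int_pow_closed[OF E y(1)] .
      moreover have "(y [^] p) [^] (p ^ k) \<in> B" using y yc by (simp add: int_pow_pow)
      ultimately obtain r where r: "r \<in> R" "y [^] p \<otimes> inv r \<in> B" using R(3) by blast
      then have fr: "f r \<in> E" "f r [^] p \<otimes> inv r \<in> B" "r \<in> R'" using f[of r] y(1) by (auto simp: R'_def)
      have c: "f r \<in> carrier G" "r \<in> carrier G" using fr(1) Ec r(1) R(2) by auto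
      have "(y \<otimes> inv (f r)) [^] p = (y [^] p \<otimes> inv r) \<otimes> inv (f r [^] p \<otimes> inv r)"
      proof -
        have "(y [^] p \<otimes> inv r) \<otimes> inv (f r [^] p \<otimes> inv r) = y [^] p \<otimes> inv (f r [^] p) \<otimes> (inv r \<otimes> r)"
          using c yc by (simp only: inv_mult inv_closed inv_inv m_ac m_closed int_pow_closed)
        then show ?thesis using c yc by (simp add: int_pow_distrib int_pow_inv)
      qed
      also have "\<dots> \<in> B" using r fr B(1) by (simp add: subgroup.m_closed subgroup.m_inv_closed)
      finally have "(y \<otimes> inv (f r)) [^] p \<in> B" .
      moreover have "y \<otimes> inv (f r) \<in> E" using y fr E by (simp add: subgroup.m_closed subgroup.m_inv_closed)
      ultimately obtain t where t: "t \<in> T" "y \<otimes> inv (f r) \<otimes> inv t \<in> B" using socle by blast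
      have "y \<otimes> inv (f r \<otimes> t) \<in> B" using t c yc Tc by (simp add: inv_mult m_assoc)
      then show ?thesis using set_multI[of "f r" "f ` R'" t T] fr t by blast
    qed
    ultimately show ?case by blast
  qed
  from this[of N] obtain R where R: "finite R" "R \<subseteq> carrier G"
    "\<And>y. \<lbrakk>y \<in> E; y [^] (p ^ N) \<in> B\<rbrakk> \<Longrightarrow> \<exists>r\<in>R. y \<otimes> inv r \<in> B" by blast
  have "fin_idx B E"
    unfolding fin_idx_def
  proof (intro exI conjI ballI)
    show "finite (R \<inter> E)" using R by blast
    fix x assume x: "x \<in> E"
    then have "x [^] (p ^ N) \<in> B" using subgroup.one_closed[OF B(1)] by (simp add: E_def tors_def)
    then obtain r where r: "r \<in> R" "x \<otimes> inv r \<in> B" using R(3) x by blast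
    then have "inv (x \<otimes> inv r) \<otimes> x \<in> E"
      using subgroup.m_closed[OF E subgroup.m_inv_closed[OF E]] B(2) x by blast
    moreover have "inv (x \<otimes> inv r) \<otimes> x = r"
    proof -
      have rc: "r \<in> carrier G" using r(1) R(2) by blast
      have "inv (x \<otimes> inv r) \<otimes> x = r \<otimes> (inv x \<otimes> x)"
        using rc Ec[OF x] by (simp only: inv_mult inv_closed inv_inv m_ac m_closed)
      then show ?thesis using rc Ec[OF x] by simp
    qed
    ultimately have "r \<in> E" by simp
    then show "\<exists>r\<in>R \<inter> E. x \<otimes> inv r \<in> B" using r by blast
  qed auto
  then show ?thesis using B unfolding E_def by blast
qed

section \<open>Deviation from a power map\<close>

lemma coset_factor: "\<lbrakk>x \<in> carrier G; r \<in> carrier G\<rbrakk> \<Longrightarrow> x = (x \<otimes> inv r) \<otimes> r"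
  by (simp add: m_assoc)

lemma inertialD:
  assumes "inertial \<gamma>"
  shows "\<gamma> \<in> hom G G" "inj_on \<gamma> (carrier G)"
  using assms by (auto simp: inertial_def)

lemma tors_carrier: "x \<in> tors m \<Longrightarrow> x \<in> carrier G"
  by (simp add: tors_def)

lemma hom_tors: "\<lbrakk>\<gamma> \<in> hom G G; x \<in> tors m\<rbrakk> \<Longrightarrow> \<gamma> x \<in> tors m"
  using hom_ipow[of \<gamma> x m] by (simp add: tors_def hom_in_carrier hom_one[OF _ is_group is_group])

text \<open>The deviation of \<open>\<gamma>\<close> from raising to the power \<open>k\<close>.\<close>

definition defect :: "('a \<Rightarrow> 'a) \<Rightarrow> int \<Rightarrow> 'a \<Rightarrow> 'a" where
  "defect \<gamma> k x = \<gamma> x \<otimes> inv (x [^] k)"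

lemma defect_hom:
  assumes "\<gamma> \<in> hom G G"
  shows "defect \<gamma> k \<in> hom G G"
proof (rule homI)
  fix x y assume x: "x \<in> carrier G" "y \<in> carrier G"
  have "defect \<gamma> k (x \<otimes> y) = \<gamma> x \<otimes> \<gamma> y \<otimes> inv (x [^] k \<otimes> y [^] k)"
    using x hom_mult[OF assms] by (simp add: defect_def int_pow_distrib)
  also have "\<dots> = defect \<gamma> k x \<otimes> defect \<gamma> k y"
    using x hom_in_carrier[OF assms] by (simp only: defect_def inv_mult m_ac m_closed inv_closed int_pow_closed)
  finally show "defect \<gamma> k (x \<otimes> y) = defect \<gamma> k x \<otimes> defect \<gamma> k y" .
qed (use hom_in_carrier[OF assms] in \<open>simp add: defect_def\<close>)

lemma defect_eq: "\<lbrakk>\<gamma> \<in> hom G G; x \<in> carrier G\<rbrakk> \<Longrightarrow> \<gamma> x = defect \<gamma> k x \<otimes> x [^] k"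
  using coset_factor[of "\<gamma> x" "x [^] k"] by (simp add: defect_def hom_in_carrier)

lemma defect_one_iff: "\<lbrakk>\<gamma> \<in> hom G G; x \<in> carrier G\<rbrakk> \<Longrightarrow> defect \<gamma> k x = \<one> \<longleftrightarrow> \<gamma> x = x [^] k"
  by (simp add: defect_def right_divide_eq_iff hom_in_carrier)

lemma hom_m_inv: "\<lbrakk>\<gamma> \<in> hom G G; x \<in> carrier G\<rbrakk> \<Longrightarrow> \<gamma> (inv x) = inv \<gamma> x"
  using hom_ipow[of \<gamma> x "-1"] by (simp add: int_pow_neg hom_in_carrier)

lemma finite_subgroup_containing:
  assumes "finite S" "S \<subseteq> carrier G"
  shows "\<exists>T. subgroup T G \<and> finite T \<and> S \<subseteq> T"
  using assms
proof (induction S rule: finite_induct)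
  case empty
  then show ?case using triv_subgroup by (intro exI[of _ "{\<one>}"]) auto
next
  case (insert x S)
  then obtain T where "subgroup T G" "finite T" "S \<subseteq> T" by auto
  then show ?case using finite_subgroup_extend[of T x] insert by blast
qed

lemma subgroup_kernel_Int:
  assumes \<theta>: "\<theta> \<in> hom G G" and C: "subgroup C G"
  shows "subgroup {z \<in> C. \<theta> z = \<one>} G"
proof (rule subgroupI)
  have c: "z \<in> carrier G" if "z \<in> C" for z using subgroup.mem_carrier[OF C that] .
  show "{z \<in> C. \<theta> z = \<one>} \<subseteq> carrier G" using c by auto
  show "{z \<in> C. \<theta> z = \<one>} \<noteq> {}" using subgroup.one_closed[OF C] hom_one[OF \<theta> is_group is_group] by auto
  show "inv a \<in> {z \<in> C. \<theta> z = \<one>}" if "a \<in> {z \<in> C. \<theta> z = \<one>}" for a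
    using that c subgroup.m_inv_closed[OF C] by (simp add: hom_m_inv[OF \<theta>])
  show "a \<otimes> b \<in> {z \<in> C. \<theta> z = \<one>}" if "a \<in> {z \<in> C. \<theta> z = \<one>}" "b \<in> {z \<in> C. \<theta> z = \<one>}" for a b
    using that c subgroup.m_closed[OF C] by (simp add: hom_mult[OF \<theta>])
qed

lemma fin_idxE:
  assumes "fin_idx B E"
  obtains R f where "finite R" "R \<subseteq> E" "\<And>x. x \<in> E \<Longrightarrow> f x \<in> R" "\<And>x. x \<in> E \<Longrightarrow> x \<otimes> inv (f x) \<in> B"
proof -
  obtain R where R: "finite R" "R \<subseteq> E" "\<forall>x\<in>E. \<exists>r\<in>R. x \<otimes> inv r \<in> B"
    using assms unfolding fin_idx_def by auto
  define f where "f x = (SOME r. r \<in> R \<and> x \<otimes> inv r \<in> B)" for x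
  have "f x \<in> R \<and> x \<otimes> inv (f x) \<in> B" if "x \<in> E" for x
    unfolding f_def by (rule someI_ex) (use R(3) that in blast)
  then show thesis using that R by blast
qed

lemma fin_idx_kernel:
  assumes \<theta>: "\<theta> \<in> hom G G" and C: "subgroup C G" and E: "E \<subseteq> carrier G" and idx: "fin_idx C E"
    and fin: "finite (\<theta> ` C)"
  shows "fin_idx {z \<in> C. \<theta> z = \<one>} E"
proof -
  obtain R f where R: "finite R" "R \<subseteq> E"
    and f: "\<And>x. x \<in> E \<Longrightarrow> f x \<in> R" "\<And>x. x \<in> E \<Longrightarrow> x \<otimes> inv (f x) \<in> C" using fin_idxE[OF idx] by metis
  have Cc: "z \<in> carrier G" if "z \<in> C" for z using subgroup.mem_carrier[OF C that] .
  show ?thesis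
  proof (rule fin_idxI[of "\<lambda>x. (f x, \<theta> (x \<otimes> inv (f x)))"])
    have "(\<lambda>x. (f x, \<theta> (x \<otimes> inv (f x)))) ` E \<subseteq> R \<times> \<theta> ` C" using f by auto
    then show "finite ((\<lambda>x. (f x, \<theta> (x \<otimes> inv (f x)))) ` E)" using R fin by (meson finite_SigmaI finite_subset)
    fix x y assume xy: "x \<in> E" "y \<in> E" and "(f x, \<theta> (x \<otimes> inv (f x))) = (f y, \<theta> (y \<otimes> inv (f y)))"
    then have eq: "f y = f x" "\<theta> (y \<otimes> inv (f x)) = \<theta> (x \<otimes> inv (f x))" by auto
    have a: "x \<otimes> inv (f x) \<in> C" "y \<otimes> inv (f x) \<in> C" using f xy eq(1) by fastforce+
    have c: "x \<in> carrier G" "y \<in> carrier G" "f x \<in> carrier G" using xy E R(2) f by auto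
    have "(x \<otimes> inv (f x)) \<otimes> inv (y \<otimes> inv (f x)) = x \<otimes> inv y \<otimes> (inv (f x) \<otimes> f x)"
      using c by (simp only: inv_mult inv_closed inv_inv m_ac m_closed)
    then have xy': "x \<otimes> inv y = (x \<otimes> inv (f x)) \<otimes> inv (y \<otimes> inv (f x))" using c by simp
    have "x \<otimes> inv y \<in> C"
      unfolding xy' using a subgroup.m_closed[OF C _ subgroup.m_inv_closed[OF C]] by blast
    moreover have "\<theta> (x \<otimes> inv y) = \<one>"
      unfolding xy' using eq(2) hom_in_carrier[OF \<theta> Cc[OF a(1)]] Cc[OF a(1)] Cc[OF a(2)]
      by (simp add: hom_mult[OF \<theta>] hom_m_inv[OF \<theta>])
    ultimately show "x \<otimes> inv y \<in> {z \<in> C. \<theta> z = \<one>}" by blast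
  qed
qed

lemma fin_idx_image_finite:
  assumes \<theta>: "\<theta> \<in> hom G G" and E: "E \<subseteq> carrier G" and idx: "fin_idx C E" and C: "subgroup C G"
    and fin: "finite (\<theta> ` C)"
  shows "finite (\<theta> ` E)"
proof -
  obtain R f where R: "finite R" "R \<subseteq> E"
    and f: "\<And>x. x \<in> E \<Longrightarrow> f x \<in> R" "\<And>x. x \<in> E \<Longrightarrow> x \<otimes> inv (f x) \<in> C" using fin_idxE[OF idx] by metis
  have "\<theta> x \<in> \<theta> ` C <#> \<theta> ` R" if x: "x \<in> E" for x
  proof -
    obtain r where r: "r \<in> R" "x \<otimes> inv r \<in> C" using f x by blast
    have c: "x \<in> carrier G" "r \<in> carrier G" using x r(1) E R(2) by auto
    have "\<theta> x = \<theta> ((x \<otimes> inv r) \<otimes> r)" by (rule arg_cong[OF coset_factor[OF c]])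
    also have "\<dots> = \<theta> (x \<otimes> inv r) \<otimes> \<theta> r" by (rule hom_mult[OF \<theta>]) (use c in auto)
    finally show ?thesis using set_multI[of "\<theta> (x \<otimes> inv r)" "\<theta> ` C" "\<theta> r" "\<theta> ` R"] r by auto
  qed
  then have "\<theta> ` E \<subseteq> \<theta> ` C <#> \<theta> ` R" by blast
  then show ?thesis using finite_set_mult[OF fin] R(1) finite_subset by blast
qed

lemma scalar_not_dvd:
  fixes p :: int
  assumes \<gamma>: "\<gamma> \<in> hom G G" "inj_on \<gamma> (carrier G)" and C: "subgroup C G"
    and sc: "\<And>z. z \<in> C \<inter> tors p \<Longrightarrow> \<gamma> z = z [^] k" and z: "z \<in> C" "z \<in> ppart p" "z \<noteq> \<one>"
  shows "\<not> p dvd k"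
proof
  assume dvd: "p dvd k"
  have zc: "z \<in> carrier G" using z by (simp add: ppart_def)
  obtain n :: nat where n: "z [^] (p ^ Suc n) = \<one>" "z [^] (p ^ n) \<noteq> \<one>" using ppart_last_power[OF z(2,3)] .
  define y where "y = z [^] (p ^ n)"
  have y: "y \<in> C" "y \<in> carrier G" "y [^] p = \<one>"
    using subgroup_int_pow_closed[OF C z(1)] n(1) zc by (auto simp: y_def int_pow_pow mult.commute)
  then have "\<gamma> y = \<one>" using sc[of y] int_pow_one_dvd[OF y(2,3) dvd] by (simp add: tors_def)
  then have "\<gamma> y = \<gamma> \<one>" using hom_one[OF \<gamma>(1) is_group is_group] by simp
  then have "y = \<one>" using \<gamma>(2) y(2) by (auto dest: inj_onD)
  then show False using n y_def by simp
qed

section \<open>Action on bounded torsion\<close>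

text \<open>On the elements killed by \<open>p^N\<close>, \<open>g\<close> is raising to a power \<open>k\<close> prime to \<open>p\<close>, up to factors in \<open>F\<close>, and exactly so on \<open>C\<close>.
  For prime \<open>p\<close> and fixed subgroups \<open>F\<close> and \<open>C \<subseteq> A[p\<^sup>N]\<close> the automorphisms with this property form a group.\<close>

definition almost_scalar :: "int \<Rightarrow> nat \<Rightarrow> 'a set \<Rightarrow> 'a set \<Rightarrow> ('a \<Rightarrow> 'a) \<Rightarrow> bool" where
  "almost_scalar p N F C g \<longleftrightarrow> (\<exists>k. \<not> p dvd k \<and> (\<forall>x\<in>tors (p ^ N). defect g k x \<in> F) \<and> (\<forall>x\<in>C. g x = x [^] k))"

lemma inertial_almost_scalar:
  fixes p :: int
  assumes p: "Factorial_Ring.prime p" and \<gamma>: "inertial \<gamma>"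
  shows "\<exists>F C. subgroup F G \<and> finite F \<and> subgroup C G \<and> C \<subseteq> tors (p ^ N) \<and> fin_idx C (tors (p ^ N)) \<and> almost_scalar p N F C \<gamma>"
proof -
  note hom = inertialD(1)[OF \<gamma>]
  obtain T where T: "subgroup T G" "finite T"
    and key: "\<And>x. \<lbrakk>x \<in> carrier G; \<And>k::int. x [^] k \<in> T \<Longrightarrow> x [^] k = \<one>\<rbrakk> \<Longrightarrow> \<exists>k::int. \<gamma> x \<otimes> inv (x [^] k) \<in> T"
    using inertial_finite_subgroup[OF \<gamma>] by blast
  define E where "E = tors (p ^ N)"
  have E: "subgroup E G" unfolding E_def by (rule subgroup_tors)
  note EC = subgroup.subset[OF E]
  obtain B where B: "subgroup B G" "B \<subseteq> E" "fin_idx B E" "B \<inter> T = {\<one>}"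
    using fin_idx_avoiding[OF p T] unfolding E_def by metis
  have Bc: "z \<in> carrier G" if "z \<in> B" for z using subgroup.mem_carrier[OF B(1) that] .
  have keyB: "\<exists>k. defect \<gamma> k x \<in> T" if x: "x \<in> B" for x
    unfolding defect_def
  proof (rule key[OF Bc[OF x]])
    show "x [^] k = \<one>" if "x [^] k \<in> T" for k :: int
      using subgroup_int_pow_closed[OF B(1) x] that B(4) by blast
  qed
  \<comment> \<open>\<open>x\<close> has maximal order in \<open>B\<close>.\<close>
  obtain x e where x: "x \<in> B" and e: "\<And>z. z \<in> B \<Longrightarrow> z [^] (p ^ e) = \<one>"
    and xdvd: "\<And>k::int. x [^] k = \<one> \<Longrightarrow> p ^ e dvd k"
  proof -
    define e where "e = (LEAST e. \<forall>z\<in>B. z [^] (p ^ e) = \<one>)"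
    have e: "\<forall>z\<in>B. z [^] (p ^ e) = \<one>"
      unfolding e_def by (rule LeastI[of _ N]) (use B(2) in \<open>auto simp: E_def tors_def\<close>)
    show thesis
    proof (cases e)
      case 0
      then show ?thesis using that[of \<one> e] e subgroup.one_closed[OF B(1)] by auto
    next
      case (Suc m)
      then have "\<not> (\<forall>z\<in>B. z [^] (p ^ m) = \<one>)"
        using not_less_Least[of m "\<lambda>e. \<forall>z\<in>B. z [^] (p ^ e) = \<one>"] unfolding e_def by auto
      then obtain x where x: "x \<in> B" "x [^] (p ^ m) \<noteq> \<one>" by blast
      show ?thesis
      proof (rule that[OF x(1)])
        show "z [^] (p ^ e) = \<one>" if "z \<in> B" for z using e that by blast
        show "p ^ e dvd k" if "x [^] k = \<one>" for k :: int
          using prime_power_order[OF p Bc[OF x(1)] _ x(2) that] e x(1) Suc by auto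
      qed
    qed
  qed
  obtain a where a: "defect \<gamma> a x \<in> T" using keyB[OF x] by blast
  obtain T2 where T2: "subgroup T2 G" "finite T2" "x \<in> T2"
    using finite_subgroup_extend[OF T Bc[OF x]] by blast
  obtain B2 where B2: "subgroup B2 G" "B2 \<subseteq> E" "fin_idx B2 E" "B2 \<inter> T2 = {\<one>}"
    using fin_idx_avoiding[OF p T2(1,2)] unfolding E_def by metis
  \<comment> \<open>On \<open>C0\<close>, the power belonging to \<open>x\<close> works up to factors in \<open>T\<close>: compare \<open>x\<close>, \<open>z\<close> and \<open>x \<otimes> z\<close>.\<close>
  define C0 where "C0 = B \<inter> B2"
  have C0: "subgroup C0 G" "fin_idx C0 E" "C0 \<subseteq> E"
    using subgroups_Inter_pair[OF B(1) B2(1)] fin_idx_Int[OF B(1,3) B2(1,3) EC] B(2) unfolding C0_def by auto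
  define \<theta> where "\<theta> = defect \<gamma> a"
  have \<theta>: "\<theta> \<in> hom G G" unfolding \<theta>_def using hom by (rule defect_hom)
  have \<theta>T: "\<theta> z \<in> T" if "z \<in> C0" for z
  proof -
    have z: "z \<in> B" "z \<in> B2" using that by (auto simp: C0_def)
    note c = Bc[OF x] Bc[OF z(1)]
    obtain k where k: "defect \<gamma> k z \<in> T" using keyB[OF z(1)] by blast
    obtain b where b: "defect \<gamma> b (x \<otimes> z) \<in> T" using keyB[of "x \<otimes> z"] subgroup.m_closed[OF B(1) x z(1)] by blast
    define u where "u = x [^] (a - b) \<otimes> z [^] (k - b)"
    have uB: "u \<in> B" unfolding u_def using x z by (intro subgroup.m_closed[OF B(1)] subgroup_int_pow_closed[OF B(1)])
    have gc: "\<gamma> x \<in> carrier G" "\<gamma> z \<in> carrier G" using c hom_in_carrier[OF hom] by auto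
    have "u \<otimes> (defect \<gamma> a x \<otimes> defect \<gamma> k z) = defect \<gamma> b x \<otimes> defect \<gamma> b z"
    proof -
      have "u \<otimes> (defect \<gamma> a x \<otimes> defect \<gamma> k z) = \<gamma> x \<otimes> \<gamma> z \<otimes> (x [^] (a - b) \<otimes> inv (x [^] a)) \<otimes> (z [^] (k - b) \<otimes> inv (z [^] k))"
        using c gc by (simp only: u_def defect_def m_ac m_closed inv_closed int_pow_closed)
      also have "x [^] (a - b) \<otimes> inv (x [^] a) = inv (x [^] b)"
        using c by (simp add: int_pow_neg[symmetric] int_pow_mult[symmetric])
      also have "z [^] (k - b) \<otimes> inv (z [^] k) = inv (z [^] b)"
        using c by (simp add: int_pow_neg[symmetric] int_pow_mult[symmetric])
      finally show ?thesis using c gc by (simp only: defect_def m_ac m_closed inv_closed int_pow_closed)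
    qed
    also have "\<dots> = defect \<gamma> b (x \<otimes> z)" using hom_mult[OF defect_hom[OF hom]] c by simp
    finally have "u \<otimes> (defect \<gamma> a x \<otimes> defect \<gamma> k z) \<in> T" using b by simp
    moreover have tt: "defect \<gamma> a x \<otimes> defect \<gamma> k z \<in> T" using subgroup.m_closed[OF T(1) a k] .
    ultimately have "u \<otimes> (defect \<gamma> a x \<otimes> defect \<gamma> k z) \<otimes> inv (defect \<gamma> a x \<otimes> defect \<gamma> k z) \<in> T"
      using subgroup.m_closed[OF T(1) _ subgroup.m_inv_closed[OF T(1)]] by blast
    then have "u \<in> T" using Bc[OF uB] subgroup.mem_carrier[OF T(1) tt] by (simp add: m_assoc)
    then have u1: "u = \<one>" using uB B(4) by blast
    then have "z [^] (k - b) = inv (x [^] (a - b))"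
      using c unfolding u_def by (metis int_pow_closed inv_equality inv_inv m_comm)
    then have "z [^] (k - b) \<in> T2" using subgroup.m_inv_closed[OF T2(1) subgroup_int_pow_closed[OF T2(1,3)]] by simp
    then have zkb: "z [^] (k - b) = \<one>" using subgroup_int_pow_closed[OF B2(1) z(2)] B2(4) by blast
    then have "x [^] (a - b) = \<one>" using u1 c by (simp add: u_def)
    then have "z [^] (a - b) = \<one>" using xdvd int_pow_one_dvd[OF c(2) e[OF z(1)]] by blast
    then have "z [^] a = z [^] k" using zkb c by (simp add: int_pow_diff right_divide_eq_iff)
    then show ?thesis using k by (simp add: \<theta>_def defect_def)
  qed
  have fin: "finite (\<theta> ` C0)" using \<theta>T T(2) finite_subset[of "\<theta> ` C0" T] by blast
  define C where "C = {z \<in> C0. \<theta> z = \<one>}"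
  have C: "subgroup C G" "fin_idx C E" "C \<subseteq> E"
    using subgroup_kernel_Int[OF \<theta> C0(1)] fin_idx_kernel[OF \<theta> C0(1) EC C0(2) fin] C0(3) unfolding C_def by auto
  have Ca: "\<gamma> z = z [^] a" if "z \<in> C" for z
    using that defect_one_iff[OF hom subgroup.mem_carrier[OF C(1) that], of a] by (simp add: C_def \<theta>_def)
  show ?thesis
  proof (cases "C = {\<one>}")
    case True
    \<comment> \<open>Here \<open>E\<close> is finite, and \<open>F = E\<close> admits every exponent.\<close>
    obtain R f where R: "finite R" "R \<subseteq> E"
      and f: "\<And>x. x \<in> E \<Longrightarrow> f x \<in> R" "\<And>x. x \<in> E \<Longrightarrow> x \<otimes> inv (f x) \<in> C" using fin_idxE[OF C(2)] by metis
    have "E \<subseteq> R"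
    proof
      fix y assume y: "y \<in> E"
      then obtain r where r: "r \<in> R" "y \<otimes> inv r = \<one>" using f[of y] True by auto
      then have "y = r" using right_divide_eq_iff[of y r \<one>] y EC R(2) by auto
      then show "y \<in> R" using r by simp
    qed
    then have "finite E" using R(1) finite_subset by blast
    moreover have "almost_scalar p N E C \<gamma>"
      unfolding almost_scalar_def
    proof (intro exI[of _ 1] conjI ballI)
      show "\<not> p dvd 1" using p not_prime_unit by blast
      show "defect \<gamma> 1 y \<in> E" if "y \<in> tors (p ^ N)" for y
      proof -
        have "y \<in> E" "\<gamma> y \<in> E" using hom_tors[OF hom that] that by (auto simp: E_def)
        then show ?thesis unfolding defect_def
          using subgroup.m_closed[OF E _ subgroup.m_inv_closed[OF E]] subgroup_int_pow_closed[OF E] by blast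
      qed
      show "\<gamma> y = y [^] (1::int)" if "y \<in> C" for y
        using that True hom_one[OF hom is_group is_group] by simp
    qed
    ultimately show ?thesis using E C unfolding E_def by blast
  next
    case False
    then obtain z where z: "z \<in> C" "z \<noteq> \<one>" using subgroup.one_closed[OF C(1)] by blast
    then have "z \<in> ppart p" using C(3) tors_ppart unfolding E_def by blast
    then have na: "\<not> p dvd a"
      using scalar_not_dvd[OF inertialD[OF \<gamma>] C(1) _ z(1) _ z(2)] Ca by blast
    have "finite (\<theta> ` E)" using fin_idx_image_finite[OF \<theta> EC C0(2,1) fin] .
    moreover have "\<theta> ` E \<subseteq> carrier G" using hom_in_carrier[OF \<theta>] EC by blast
    ultimately obtain F where F: "subgroup F G" "finite F" "\<theta> ` E \<subseteq> F"
      using finite_subgroup_containing by blast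
    have "almost_scalar p N F C \<gamma>"
      unfolding almost_scalar_def
    proof (intro exI[of _ a] conjI ballI)
      show "defect \<gamma> a y \<in> F" if "y \<in> tors (p ^ N)" for y using F(3) that by (auto simp: E_def \<theta>_def)
    qed (use na Ca in auto)
    then show ?thesis using F C unfolding E_def by blast
  qed
qed

section \<open>Finitely generated groups of inertial automorphisms\<close>

lemma autoD:
  assumes "g \<in> auto G"
  shows "g \<in> hom G G" "inj_on g (carrier G)" "g ` carrier G = carrier G" "g \<in> extensional (carrier G)"
  using assms by (auto simp: auto_def Bij_def bij_betw_def)

lemma carrier_AutoGroup [simp]: "carrier (AutoGroup G) = auto G"
  by (simp add: AutoGroup_def)

lemma AutoGroup_mult:
  assumes "g \<in> auto G" "h \<in> auto G" "x \<in> carrier G"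
  shows "(g \<otimes>\<^bsub>AutoGroup G\<^esub> h) x = g (h x)"
  using assms by (auto simp: AutoGroup_def BijGroup_def auto_def compose_def)

lemma AutoGroup_one: "x \<in> carrier G \<Longrightarrow> \<one>\<^bsub>AutoGroup G\<^esub> x = x"
  by (simp add: AutoGroup_def BijGroup_def)

lemma AutoGroup_inv:
  assumes "g \<in> auto G" "x \<in> carrier G"
  shows "g ((inv\<^bsub>AutoGroup G\<^esub> g) x) = x"
proof -
  interpret A: group "AutoGroup G" by (rule AutoGroup)
  have "(g \<otimes>\<^bsub>AutoGroup G\<^esub> inv\<^bsub>AutoGroup G\<^esub> g) x = x"
    using A.r_inv[of g] assms AutoGroup_one by simp
  then show ?thesis using AutoGroup_mult[of g "inv\<^bsub>AutoGroup G\<^esub> g" x] A.inv_closed[of g] assms by simp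
qed

lemma AutoGroup_generate_induct:
  assumes g: "g \<in> generate (AutoGroup G) J" and J: "J \<subseteq> auto G"
    and one: "\<And>g. \<lbrakk>g \<in> auto G; \<And>x. x \<in> carrier G \<Longrightarrow> g x = x\<rbrakk> \<Longrightarrow> P g"
    and gen: "\<And>g. g \<in> J \<Longrightarrow> P g"
    and mult: "\<And>g h k. \<lbrakk>g \<in> auto G; h \<in> auto G; k \<in> auto G; P g; P h; \<And>x. x \<in> carrier G \<Longrightarrow> k x = g (h x)\<rbrakk> \<Longrightarrow> P k"
    and inv: "\<And>g h. \<lbrakk>g \<in> auto G; h \<in> auto G; P g; \<And>x. x \<in> carrier G \<Longrightarrow> g (h x) = x\<rbrakk> \<Longrightarrow> P h"
  shows "P g"
proof -
  interpret A: group "AutoGroup G" by (rule AutoGroup)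
  have J': "J \<subseteq> carrier (AutoGroup G)" using J by simp
  have cl: "h \<in> auto G" if "h \<in> generate (AutoGroup G) J" for h
    using A.generate_in_carrier[OF J' that] by simp
  show ?thesis
    using g
  proof (induction g rule: generate.induct)
    case one
    have "\<one>\<^bsub>AutoGroup G\<^esub> \<in> auto G" using A.one_closed by simp
    then show ?case by (rule assms(3)) (rule AutoGroup_one)
  next
    case (incl h) then show ?case by (rule gen)
  next
    case (inv h)
    then have h: "h \<in> auto G" using J by blast
    then have "inv\<^bsub>AutoGroup G\<^esub> h \<in> auto G" using A.inv_closed[of h] by simp
    then show ?case by (rule assms(6)[OF h _ gen[OF inv]]) (rule AutoGroup_inv[OF h])
  next
    case (eng h1 h2)
    have h: "h1 \<in> auto G" "h2 \<in> auto G" using eng(1,2) cl by auto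
    then have "h1 \<otimes>\<^bsub>AutoGroup G\<^esub> h2 \<in> auto G" using A.m_closed[of h1 h2] by simp
    then show ?case by (rule mult[OF h _ eng(3,4)]) (rule AutoGroup_mult[OF h])
  qed
qed

lemma almost_scalar_generate:
  fixes p :: int
  assumes p: "Factorial_Ring.prime p" and F: "subgroup F G" and C: "subgroup C G" "C \<subseteq> tors (p ^ N)"
    and J: "J \<subseteq> auto G" "\<And>\<gamma>. \<gamma> \<in> J \<Longrightarrow> almost_scalar p N F C \<gamma>"
    and g: "g \<in> generate (AutoGroup G) J"
  shows "almost_scalar p N F C g"
proof (rule AutoGroup_generate_induct[OF g J(1)])
  note Ec = tors_carrier
  have Fc: "x \<in> carrier G" if "x \<in> F" for x using subgroup.mem_carrier[OF F that] .
  have Cc: "x \<in> carrier G" if "x \<in> C" for x using subgroup.mem_carrier[OF C(1) that] .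
  show "almost_scalar p N F C g" if "g \<in> J" for g using J(2)[OF that] .
  show "almost_scalar p N F C g" if "g \<in> auto G" and id: "\<And>x. x \<in> carrier G \<Longrightarrow> g x = x" for g
    unfolding almost_scalar_def
  proof (intro exI[of _ 1] conjI ballI)
    show "\<not> p dvd 1" using p not_prime_unit by blast
  qed (use id Ec Cc subgroup.one_closed[OF F] in \<open>auto simp: defect_def\<close>)
  show "almost_scalar p N F C q" if gh: "g \<in> auto G" "h \<in> auto G" "almost_scalar p N F C g" "almost_scalar p N F C h"
      "\<And>x. x \<in> carrier G \<Longrightarrow> q x = g (h x)" for g h q
  proof -
    note homg = autoD(1)[OF gh(1)] and homh = autoD(1)[OF gh(2)]
    obtain k l where k: "\<not> p dvd k" "\<And>x. x \<in> tors (p ^ N) \<Longrightarrow> defect h k x \<in> F" "\<And>x. x \<in> C \<Longrightarrow> h x = x [^] k"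
      and l: "\<not> p dvd l" "\<And>x. x \<in> tors (p ^ N) \<Longrightarrow> defect g l x \<in> F" "\<And>x. x \<in> C \<Longrightarrow> g x = x [^] l"
      using gh(3,4) unfolding almost_scalar_def by metis
    show ?thesis
      unfolding almost_scalar_def
    proof (intro exI[of _ "k * l"] conjI ballI)
      show "\<not> p dvd k * l" using k l p by (simp add: prime_dvd_mult_iff)
      show "defect q (k * l) x \<in> F" if x: "x \<in> tors (p ^ N)" for x
      proof -
        note xc = Ec[OF x]
        have hx: "h x \<in> tors (p ^ N)" using hom_tors[OF homh x] .
        have "q x = defect g l (h x) \<otimes> (h x) [^] l" using gh(5)[OF xc] defect_eq[OF homg Ec[OF hx]] by metis
        also have "h x = defect h k x \<otimes> x [^] k" using defect_eq[OF homh xc] .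
        also have "(defect h k x \<otimes> x [^] k) [^] l = defect h k x [^] l \<otimes> x [^] (k * l)"
          using xc Fc[OF k(2)[OF x]] by (simp add: int_pow_distrib int_pow_pow)
        finally have "q x = (defect g l (defect h k x \<otimes> x [^] k) \<otimes> defect h k x [^] l) \<otimes> x [^] (k * l)"
          using xc Fc[OF k(2)[OF x]] defect_eq[OF homh xc, of k] Fc[OF l(2)[OF hx]] by (simp add: m_assoc)
        then have "q x = (defect g l (h x) \<otimes> defect h k x [^] l) \<otimes> x [^] (k * l)"
          using defect_eq[OF homh xc, of k] by simp
        then have "defect q (k * l) x = defect g l (h x) \<otimes> defect h k x [^] l"
          using xc Fc[OF k(2)[OF x]] Fc[OF l(2)[OF hx]] by (simp add: defect_def right_divide_eq_iff)
        then show ?thesis using subgroup.m_closed[OF F l(2)[OF hx] subgroup_int_pow_closed[OF F k(2)[OF x]]] by simp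
      qed
      show "q x = x [^] (k * l)" if x: "x \<in> C" for x
        using gh(5)[OF Cc[OF x]] k(3)[OF x] l(3)[OF subgroup_int_pow_closed[OF C(1) x]] Cc[OF x] by (simp add: int_pow_pow)
    qed
  qed
  show "almost_scalar p N F C h" if gh: "g \<in> auto G" "h \<in> auto G" "almost_scalar p N F C g"
      "\<And>x. x \<in> carrier G \<Longrightarrow> g (h x) = x" for g h
  proof -
    note homg = autoD(1)[OF gh(1)] and homh = autoD(1)[OF gh(2)]
    obtain k where k: "\<not> p dvd k" "\<And>x. x \<in> tors (p ^ N) \<Longrightarrow> defect g k x \<in> F" "\<And>x. x \<in> C \<Longrightarrow> g x = x [^] k"
      using gh(3) unfolding almost_scalar_def by metis
    have "coprime k (p ^ Suc N)" using k(1) p by (metis coprime_commute coprime_power_left_iff prime_imp_coprime)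
    then obtain a b where ab: "a * k + b * p ^ Suc N = 1" using bezout_int[of k "p ^ Suc N"] by auto
    have ka: "x [^] (k * a) = x" if x: "x \<in> tors (p ^ N)" for x
    proof -
      have "x [^] (p ^ N) = \<one>" using x by (simp add: tors_def)
      then have "x [^] (b * p ^ Suc N) = \<one>" using int_pow_one_dvd[OF Ec[OF x], of "p ^ N" "b * p ^ Suc N"] by simp
      moreover have "x [^] (a * k + b * p ^ Suc N) = x" using ab Ec[OF x] by simp
      ultimately show ?thesis using Ec[OF x] by (simp add: int_pow_mult mult.commute del: power_Suc)
    qed
    show ?thesis
      unfolding almost_scalar_def
    proof (intro exI[of _ a] conjI ballI)
      show "\<not> p dvd a"
      proof
        assume "p dvd a"
        then have "p dvd a * k + b * p ^ Suc N" by simp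
        then show False using ab p not_prime_unit by metis
      qed
      show "defect h a x \<in> F" if x: "x \<in> tors (p ^ N)" for x
      proof -
        have y: "h x \<in> tors (p ^ N)" using hom_tors[OF homh x] .
        note c = Ec[OF x] Ec[OF y] Fc[OF k(2)[OF y]]
        have "x = defect g k (h x) \<otimes> h x [^] k" using defect_eq[OF homg c(2), of k] gh(4)[OF c(1)] by simp
        then have "x [^] a = defect g k (h x) [^] a \<otimes> h x [^] (k * a)"
          using c by (metis int_pow_closed int_pow_distrib int_pow_pow)
        then have "x [^] a = defect g k (h x) [^] a \<otimes> h x" using ka[OF y] by simp
        then have "h x = inv (defect g k (h x) [^] a) \<otimes> x [^] a" using c by (simp flip: m_assoc)
        then have "defect h a x = inv (defect g k (h x) [^] a)"
          unfolding defect_def[of h a x]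
          by (rule iffD2[OF right_divide_eq_iff[OF c(2) int_pow_closed[OF c(1)] inv_closed[OF int_pow_closed[OF c(3)]]]])
        then show ?thesis using subgroup.m_inv_closed[OF F subgroup_int_pow_closed[OF F k(2)[OF y]]] by simp
      qed
      show "h x = x [^] a" if x: "x \<in> C" for x
      proof -
        have "g (x [^] a) = g (h x)"
          using k(3)[OF subgroup_int_pow_closed[OF C(1) x]] gh(4)[OF Cc[OF x]] ka[of x] C(2) x Cc[OF x]
          by (auto simp: int_pow_pow mult.commute)
        then show ?thesis using autoD(2)[OF gh(1)] Cc[OF x] hom_in_carrier[OF homh Cc[OF x]] by (auto dest: inj_onD)
      qed
    qed
  qed
qed

lemma almost_scalar_mono:
  "\<lbrakk>almost_scalar p N F C g; F \<subseteq> F'; C' \<subseteq> C\<rbrakk> \<Longrightarrow> almost_scalar p N F' C' g"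
  unfolding almost_scalar_def by (metis subsetD)

lemma inertial_set_almost_scalar:
  fixes p :: int
  assumes p: "Factorial_Ring.prime p" and J: "finite J" "\<And>\<gamma>. \<gamma> \<in> J \<Longrightarrow> inertial \<gamma>"
  shows "\<exists>F C. subgroup F G \<and> finite F \<and> subgroup C G \<and> C \<subseteq> tors (p ^ N) \<and> fin_idx C (tors (p ^ N)) \<and>
    (\<forall>\<gamma>\<in>J. almost_scalar p N F C \<gamma>)"
  using J
proof (induction J rule: finite_induct)
  case empty
  have "fin_idx (tors (p ^ N)) (tors (p ^ N))"
    using subgroup.one_closed[OF subgroup_tors] tors_carrier
    unfolding fin_idx_def by (intro exI[of _ "{\<one>}"]) auto
  then show ?case using triv_subgroup subgroup_tors by (intro exI[of _ "{\<one>}"] exI[of _ "tors (p ^ N)"]) auto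
next
  case (insert \<gamma> J)
  then obtain F C where FC: "subgroup F G" "finite F" "subgroup C G" "C \<subseteq> tors (p ^ N)" "fin_idx C (tors (p ^ N))"
    "\<And>\<gamma>. \<gamma> \<in> J \<Longrightarrow> almost_scalar p N F C \<gamma>" by auto
  obtain F' C' where FC': "subgroup F' G" "finite F'" "subgroup C' G" "C' \<subseteq> tors (p ^ N)" "fin_idx C' (tors (p ^ N))"
    "almost_scalar p N F' C' \<gamma>" using inertial_almost_scalar[OF p, of \<gamma> N] insert by auto
  have "finite (F \<union> F')" "F \<union> F' \<subseteq> carrier G" 
    using FC(2) FC'(2) subgroup.subset[OF FC(1)] subgroup.subset[OF FC'(1)] by auto
  then obtain F2 where F2: "subgroup F2 G" "finite F2" "F \<union> F' \<subseteq> F2" using finite_subgroup_containing by metis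
  show ?case
  proof (rule exI[of _ F2], rule exI[of _ "C \<inter> C'"], intro conjI ballI)
    show "subgroup (C \<inter> C') G" using subgroups_Inter_pair[OF FC(3) FC'(3)] .
    show "fin_idx (C \<inter> C') (tors (p ^ N))"
      by (rule fin_idx_Int[OF FC(3,5) FC'(3,5)]) (auto simp: tors_def)
    show "almost_scalar p N F2 (C \<inter> C') \<delta>" if "\<delta> \<in> insert \<gamma> J" for \<delta>
      using that almost_scalar_mono[OF FC(6), of \<delta> F2 "C \<inter> C'"] almost_scalar_mono[OF FC'(6), of F2 "C \<inter> C'"] F2(3)
      by auto
  qed (use F2 FC in auto)
qed

lemma finite_image_factor:
  assumes "finite (\<Phi> ` A)" "\<And>x y. \<lbrakk>x \<in> A; y \<in> A; \<Phi> x = \<Phi> y\<rbrakk> \<Longrightarrow> f x = f y"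
  shows "finite (f ` A)"
proof -
  have "f ` A \<subseteq> (\<lambda>v. f (inv_into A \<Phi> v)) ` (\<Phi> ` A)"
  proof
    fix w assume "w \<in> f ` A"
    then obtain x where x: "x \<in> A" "w = f x" by blast
    then have "f x = f (inv_into A \<Phi> (\<Phi> x))"
      by (intro assms(2)) (auto simp: f_inv_into_f inv_into_into)
    then show "w \<in> (\<lambda>v. f (inv_into A \<Phi> v)) ` (\<Phi> ` A)" using x by blast
  qed
  then show ?thesis using assms(1) finite_surj by blast
qed

text \<open>An element \<open>g\<close> of the generated group is determined on \<open>A[p\<^sup>N]\<close> by its exponent modulo \<open>p^N\<close> and its values on finitely
  many coset representatives of \<open>C\<close>, and \<open>g r \<in> F \<langle>r\<rangle>\<close> for each representative \<open>r\<close>.\<close>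

lemma finite_restrict_tors:
  fixes p :: int
  assumes p: "Factorial_Ring.prime p" and J: "finite J" "J \<subseteq> auto G" "\<And>\<gamma>. \<gamma> \<in> J \<Longrightarrow> inertial \<gamma>"
  shows "finite ((\<lambda>g. restrict g (tors (p ^ N))) ` generate (AutoGroup G) J)"
proof -
  interpret A: group "AutoGroup G" by (rule AutoGroup)
  define E where "E = tors (p ^ N)"
  let ?\<Gamma> = "generate (AutoGroup G) J"
  have \<Gamma>: "g \<in> auto G" if "g \<in> ?\<Gamma>" for g using A.generate_in_carrier[OF _ that] J(2) by simp
  obtain F C where F: "subgroup F G" "finite F" and C: "subgroup C G" "C \<subseteq> E" "fin_idx C E"
    and FC: "\<And>\<gamma>. \<gamma> \<in> J \<Longrightarrow> almost_scalar p N F C \<gamma>"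
    using inertial_set_almost_scalar[OF p J(1,3), of N] unfolding E_def by metis
  have Ec: "x \<in> carrier G" if "x \<in> E" for x using that unfolding E_def by (rule tors_carrier)
  have "\<forall>g\<in>?\<Gamma>. \<exists>k. (\<forall>x\<in>E. defect g k x \<in> F) \<and> (\<forall>x\<in>C. g x = x [^] k)"
    using almost_scalar_generate[OF p F(1) C(1) _ J(2) FC] C(2) unfolding almost_scalar_def E_def by blast
  from bchoice[OF this] obtain k where k: "\<And>g x. \<lbrakk>g \<in> ?\<Gamma>; x \<in> E\<rbrakk> \<Longrightarrow> defect g (k g) x \<in> F"
    "\<And>g x. \<lbrakk>g \<in> ?\<Gamma>; x \<in> C\<rbrakk> \<Longrightarrow> g x = x [^] k g" by blast
  obtain R f where R: "finite R" "R \<subseteq> E" and f: "\<And>x. x \<in> E \<Longrightarrow> f x \<in> R" "\<And>x. x \<in> E \<Longrightarrow> x \<otimes> inv (f x) \<in> C"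
    using fin_idxE[OF C(3)] by metis
  define \<Phi> where "\<Phi> g = (k g mod p ^ N, restrict g R)" for g
  define V where "V = (\<Union>r\<in>R. F <#> range (\<lambda>i::int. r [^] i))"
  have gV: "g r \<in> V" if g: "g \<in> ?\<Gamma>" and r: "r \<in> R" for g r
  proof -
    have rE: "r \<in> E" using r R(2) by blast
    have "defect g (k g) r \<otimes> r [^] k g \<in> F <#> range (\<lambda>i::int. r [^] i)"
      by (rule set_multI[OF k(1)[OF g rE] rangeI])
    then have "g r \<in> F <#> range (\<lambda>i::int. r [^] i)"
      using defect_eq[OF autoD(1)[OF \<Gamma>[OF g]] Ec[OF rE], of "k g"] by argo
    then show ?thesis using r unfolding V_def by blast
  qed
  have "\<Phi> ` ?\<Gamma> \<subseteq> {0..<p ^ N} \<times> (R \<rightarrow>\<^sub>E V)"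
    using gV p by (auto simp: \<Phi>_def prime_gt_0_int)
  moreover have "finite V" unfolding V_def using R Ec F finite_powers by (auto intro!: finite_set_mult)
  ultimately have "finite (\<Phi> ` ?\<Gamma>)" using R(1) by (meson finite_PiE finite_SigmaI finite_atLeastLessThan_int finite_subset)
  then show ?thesis
  proof (rule finite_image_factor)
    fix g h assume g: "g \<in> ?\<Gamma>" and h: "h \<in> ?\<Gamma>" and "\<Phi> g = \<Phi> h"
    then have eq: "k g mod p ^ N = k h mod p ^ N" "\<And>r. r \<in> R \<Longrightarrow> g r = h r"
      unfolding \<Phi>_def by (auto simp: fun_eq_iff restrict_def split: if_splits)
    note hg = autoD(1)[OF \<Gamma>[OF g]] and hh = autoD(1)[OF \<Gamma>[OF h]]
    have "g x = h x" if x: "x \<in> E" for x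
    proof -
      let ?c = "x \<otimes> inv (f x)"
      have fx: "f x \<in> carrier G" using f(1)[OF x] R(2) Ec by blast
      have c: "?c \<in> C" "?c \<in> E" "?c \<in> carrier G" using f(2)[OF x] C(2) Ec by auto
      have "p ^ N dvd k g - k h" using eq(1) by (simp add: mod_eq_dvd_iff)
      then have "?c [^] (k g - k h) = \<one>" using int_pow_one_dvd[OF c(3)] c(2) by (auto simp: E_def tors_def)
      then have "?c [^] k g = ?c [^] k h" using c(3) by (simp add: int_pow_diff right_divide_eq_iff del: m_closed)
      then have "g ?c = h ?c" using k(2) g h c(1) by simp
      then have "g (?c \<otimes> f x) = h (?c \<otimes> f x)"
        using hom_mult[OF hg c(3) fx] hom_mult[OF hh c(3) fx] eq(2)[OF f(1)[OF x]] by simp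
      then show ?thesis using coset_factor[OF Ec[OF x] fx] by simp
    qed
    then show "restrict g (tors (p ^ N)) = restrict h (tors (p ^ N))" by (auto simp: E_def restrict_def)
  qed
qed

section \<open>The structure at one prime\<close>

text \<open>The elements of \<open>V\<close> killed by \<open>p^N\<close> have exponent exactly \<open>p^N\<close>.\<close>

definition full_exponent :: "int \<Rightarrow> nat \<Rightarrow> 'a set \<Rightarrow> bool" where
  "full_exponent p N V \<longleftrightarrow> (\<forall>k::int. (\<forall>x \<in> V \<inter> tors (p ^ N). x [^] k = \<one>) \<longrightarrow> p ^ N dvd k)"

lemma unbounded_full_exponent:
  fixes p :: int
  assumes p: "Factorial_Ring.prime p" and V: "subgroup V G" "V \<subseteq> ppart p" and unb: "\<And>m. \<not> V \<subseteq> tors (p ^ m)"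
  shows "full_exponent p N V"
  unfolding full_exponent_def
proof (intro allI impI)
  fix k :: int assume k: "\<forall>x \<in> V \<inter> tors (p ^ N). x [^] k = \<one>"
  show "p ^ N dvd k"
  proof (cases N)
    case (Suc N')
    obtain x where x: "x \<in> V" "x \<notin> tors (p ^ N')" using unb by blast
    then have xc: "x \<in> carrier G" using subgroup.mem_carrier[OF V(1)] by blast
    have "x [^] (p ^ N') \<noteq> \<one>" using x xc by (simp add: tors_def)
    then have "x \<noteq> \<one>" by auto
    then obtain m :: nat where m: "x [^] (p ^ Suc m) = \<one>" "x [^] (p ^ m) \<noteq> \<one>"
      using ppart_last_power x(1) V(2) by blast
    have "N' \<le> m"
    proof (rule ccontr)
      assume "\<not> N' \<le> m"
      then have "p ^ Suc m dvd p ^ N'" by (intro le_imp_power_dvd) auto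
      then show False using int_pow_one_dvd[OF xc m(1)] x xc by (simp add: tors_def)
    qed
    define y where "y = x [^] (p ^ (m - N'))"
    have y: "y \<in> V" "y \<in> carrier G" unfolding y_def using subgroup_int_pow_closed[OF V(1) x(1)] xc by auto
    have ypow: "y [^] (p ^ i) = x [^] (p ^ (m - N' + i))" for i
      using xc by (simp add: y_def int_pow_pow power_add)
    have "y [^] (p ^ Suc N') = \<one>" "y [^] (p ^ N') \<noteq> \<one>"
      unfolding ypow using m \<open>N' \<le> m\<close> by (simp_all del: power_Suc)
    moreover from this have "y [^] k = \<one>" using k y Suc by (auto simp: tors_def)
    ultimately show ?thesis using prime_power_order[OF p y(2)] Suc by blast
  qed simp
qed

lemma scalar_coprime:
  fixes p :: int
  assumes p: "Factorial_Ring.prime p" and \<gamma>: "\<gamma> \<in> hom G G" "inj_on \<gamma> (carrier G)"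
    and C: "subgroup C G" "C \<subseteq> ppart p" and sc: "\<And>z. z \<in> C \<Longrightarrow> \<gamma> z = z [^] (k::int)"
  shows "\<exists>k::int. \<not> p dvd k \<and> (\<forall>z\<in>C. \<gamma> z = z [^] k)"
proof (cases "C = {\<one>}")
  case True
  have "\<not> p dvd 1" using p not_prime_unit by blast
  then show ?thesis using True hom_one[OF \<gamma>(1) is_group is_group] by (intro exI[of _ 1]) auto
next
  case False
  then obtain z where z: "z \<in> C" "z \<noteq> \<one>" using subgroup.one_closed[OF C(1)] by blast
  then have "\<not> p dvd k" using scalar_not_dvd[OF \<gamma> C(1) _ z(1) _ z(2)] sc C(2) by blast
  then show ?thesis using sc by blast
qed

text \<open>An inertial endomorphism is a power map on a divisible \<open>p\<close>-group: \<open>x\<close> lies in a quasicyclic subgroup \<open>H\<close>, generated by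
  successive \<open>p\<close>-th roots of \<open>x\<close>, and \<open>\<gamma>\<close> maps \<open>H\<close> to itself, since \<open>H (\<gamma> H) / H\<close> is finite and divisible. All
  subgroups of \<open>H\<close> generated by one element are determined by their order, so \<open>\<gamma> x \<in> \<langle>x\<rangle>\<close>.\<close>

lemma inertial_divisible:
  fixes p :: int
  assumes p: "Factorial_Ring.prime p" and \<gamma>: "inertial \<gamma>"
    and V: "subgroup V G" "V \<subseteq> ppart p" and div: "\<And>x. x \<in> V \<Longrightarrow> \<exists>y\<in>V. y [^] p = x" and x: "x \<in> V"
  shows "\<exists>k::int. \<gamma> x = x [^] k"
proof (cases "x = \<one>")
  case True
  then show ?thesis using hom_one[OF inertialD(1)[OF \<gamma>] is_group is_group] by auto
next
  case False
  note hom = inertialD(1)[OF \<gamma>]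
  have "\<exists>s. \<forall>n. (s n \<in> V \<and> (n = 0 \<longrightarrow> s n = x)) \<and> s (Suc n) [^] p = s n"
  proof (rule dependent_nat_choice)
    show "\<exists>y. y \<in> V \<and> ((0::nat) = 0 \<longrightarrow> y = x)" using x by blast
    show "\<exists>z. (z \<in> V \<and> (Suc n = 0 \<longrightarrow> z = x)) \<and> z [^] p = y" if "y \<in> V \<and> (n = 0 \<longrightarrow> y = x)" for y n
      using div that by auto
  qed
  then obtain s where s: "\<And>n. s n \<in> V" "s 0 = x" "\<And>n. s (Suc n) [^] p = s n" by metis
  have sc: "s n \<in> carrier G" for n using subgroup.mem_carrier[OF V(1) s(1)] .
  have spow: "s (m + n) [^] (p ^ n) = s m" for m n
  proof (induction n)
    case (Suc n)
    have "s (m + Suc n) [^] (p ^ Suc n) = (s (Suc (m + n)) [^] p) [^] (p ^ n)"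
      using sc by (simp add: int_pow_pow)
    then show ?case using Suc s(3) by simp
  qed (use sc in simp)
  define H where "H = (\<Union>n. range (\<lambda>k::int. s n [^] k))"
  have Hmono: "range (\<lambda>k::int. s m [^] k) \<subseteq> range (\<lambda>k::int. s (m + n) [^] k)" for m n
    using int_pow_pow[OF sc, of "m + n" "p ^ n"] spow[of m n] by auto
  have H: "subgroup H G"
  proof (rule subgroupI)
    show "H \<subseteq> carrier G" using sc by (auto simp: H_def)
    show "H \<noteq> {}" by (auto simp: H_def)
    show "inv a \<in> H" if "a \<in> H" for a
    proof -
      obtain n k where "a = s n [^] (k::int)" using \<open>a \<in> H\<close> by (auto simp: H_def)
      then have "inv a = s n [^] (- k)" using sc by (simp add: int_pow_neg)
      then show ?thesis by (auto simp: H_def)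
    qed
    show "a \<otimes> b \<in> H" if ab: "a \<in> H" "b \<in> H" for a b
    proof -
      obtain m n where "a \<in> range (\<lambda>k::int. s m [^] k)" "b \<in> range (\<lambda>k::int. s n [^] k)"
        using ab by (auto simp: H_def)
      then have "a \<in> range (\<lambda>k::int. s (m + n) [^] k)" "b \<in> range (\<lambda>k::int. s (m + n) [^] k)"
        using subsetD[OF Hmono[of m n]] subsetD[OF Hmono[of n m]] by (auto simp: add.commute)
      then have "a \<otimes> b \<in> range (\<lambda>k::int. s (m + n) [^] k)"
        using subgroup.m_closed[OF subgroup_powers[OF sc]] by blast
      then show ?thesis by (auto simp: H_def)
    qed
  qed
  have sH: "s n [^] (k::int) \<in> H" for n k by (auto simp: H_def)
  have sH1: "s n \<in> H" for n using sH[of n 1] sc by simp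
  have "range (\<lambda>n. H #> \<gamma> (s n)) \<subseteq> (\<lambda>x. H #> \<gamma> x) ` H" using sH1 by auto
  moreover have "finite ((\<lambda>x. H #> \<gamma> x) ` H)" using \<gamma> H by (simp add: inertial_def)
  ultimately have "\<not> inj (\<lambda>n. H #> \<gamma> (s n))" using finite_subset range_inj_infinite by blast
  \<comment> \<open>As \<open>s a\<close> is the power \<open>p^(b - a)\<close> of \<open>s b\<close>, the power \<open>1 - p^(b - a)\<close> of \<open>\<gamma> (s b)\<close> is in \<open>H\<close>, and that exponent is prime to \<open>p\<close>.\<close>
  then obtain a b where ab: "a < b" "H #> \<gamma> (s a) = H #> \<gamma> (s b)"
    by (metis (mono_tags, lifting) injI linorder_neqE_nat)
  have sbH: "\<gamma> (s b) \<in> H"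
  proof -
    define d where "d = b - a"
    have d: "d > 0" "s a = s b [^] (p ^ d)" using ab(1) spow[of a d] by (auto simp: d_def)
    note gc = hom_in_carrier[OF hom sc]
    have "\<gamma> (s b) \<in> H #> \<gamma> (s a)" using rcos_self[OF gc H, of b] ab(2) by argo
    then obtain h where h: "h \<in> H" "\<gamma> (s b) = h \<otimes> \<gamma> (s a)" unfolding r_coset_def by blast
    have hc: "h \<in> carrier G" using subgroup.mem_carrier[OF H h(1)] .
    have "h = \<gamma> (s b) \<otimes> inv \<gamma> (s a)" using right_divide_eq_iff[OF gc gc hc] h(2) by metis
    also have "\<gamma> (s a) = \<gamma> (s b) [^] (p ^ d)" unfolding d(2) using hom_ipow[OF hom sc] .
    also have "\<gamma> (s b) \<otimes> inv (\<gamma> (s b) [^] (p ^ d)) = \<gamma> (s b) [^] (1 - p ^ d)" using gc by (simp add: int_pow_diff)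
    finally have H1: "\<gamma> (s b) [^] (1 - p ^ d) \<in> H" using h(1) by simp
    obtain M :: nat where "s b [^] (p ^ M) = \<one>" using s(1)[of b] V(2) by (auto simp: ppart_def)
    then have M: "\<gamma> (s b) [^] (p ^ M) = \<one>"
      using hom_ipow[OF hom sc, of b "p ^ M"] hom_one[OF hom is_group is_group] by simp
    have "\<not> p dvd 1 - p ^ d"
    proof
      assume "p dvd 1 - p ^ d"
      moreover have "p dvd p ^ d" using d(1) by simp
      ultimately have "p dvd (1 - p ^ d) + p ^ d" using dvd_add by blast
      then show False using p not_prime_unit by auto
    qed
    then have "coprime (1 - p ^ d) (p ^ M)" using p
      by (metis coprime_commute coprime_power_left_iff prime_imp_coprime)
    then obtain u v where uv: "u * (1 - p ^ d) + v * p ^ M = 1" using bezout_int[of "1 - p ^ d" "p ^ M"] by auto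
    have "\<gamma> (s b) = \<gamma> (s b) [^] ((1 - p ^ d) * u + p ^ M * v)" using uv gc by (simp add: mult.commute)
    also have "\<dots> = (\<gamma> (s b) [^] (1 - p ^ d)) [^] u \<otimes> (\<gamma> (s b) [^] (p ^ M)) [^] v"
      using gc by (simp only: int_pow_mult int_pow_pow)
    also have "\<dots> = (\<gamma> (s b) [^] (1 - p ^ d)) [^] u" using M gc by simp
    also have "\<dots> \<in> H" using subgroup_int_pow_closed[OF H H1] .
    finally show ?thesis .
  qed
  have "\<gamma> x = \<gamma> (s b [^] (p ^ b))" using spow[of 0 b] s(2) by simp
  also have "\<dots> = \<gamma> (s b) [^] (p ^ b)" using hom_ipow[OF hom sc] .
  finally have "\<gamma> x \<in> H" using subgroup_int_pow_closed[OF H sbH] by simp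
  then obtain j k where jk: "\<gamma> x = s j [^] (k::int)" by (auto simp: H_def)
  have xj: "x = s j [^] (p ^ j)" using spow[of 0 j] s(2) by simp
  have xc: "x \<in> carrier G" using sc[of 0] s(2) by simp
  obtain m :: nat where m: "x [^] (p ^ Suc m) = \<one>" "x [^] (p ^ m) \<noteq> \<one>"
    using ppart_last_power[of x p] x V(2) False by blast
  have sj: "s j [^] (p ^ Suc (j + m)) = \<one>" "s j [^] (p ^ (j + m)) \<noteq> \<one>"
    using m sc[of j] unfolding xj by (simp_all add: int_pow_pow power_add mult_ac)
  have "s j [^] (k * p ^ Suc m) = \<gamma> (x [^] (p ^ Suc m))"
    using sc jk hom_ipow[OF hom xc] by (simp add: int_pow_pow)
  then have "s j [^] (k * p ^ Suc m) = \<one>" using m hom_one[OF hom is_group is_group] by simp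
  then have "p ^ Suc (j + m) dvd k * p ^ Suc m" using prime_power_order[OF p sc sj] by blast
  then have "p ^ j * p ^ Suc m dvd k * p ^ Suc m" by (simp add: power_add mult_ac)
  then have "p ^ j dvd k" using p by (simp add: prime_gt_0_int)
  then obtain i where "k = p ^ j * i" by blast
  then have "\<gamma> x = x [^] i" using jk xj sc by (simp add: int_pow_pow)
  then show ?thesis by blast
qed

text \<open>The elements killed by \<open>p\<close> that are \<open>p^n\<close>-th powers in the whole group.\<close>

definition soc :: "int \<Rightarrow> nat \<Rightarrow> 'a set" where
  "soc p n = {x \<in> tors p. \<exists>y\<in>carrier G. y [^] (p ^ n) = x}"

text \<open>The \<open>p\<close>-part is the product of \<open>V\<close> and the elements killed by \<open>p^N\<close>. The last condition makes an exponent that fixes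
  the elements of \<open>V\<close> killed by \<open>p^N\<close> congruent to 1 modulo \<open>p^N\<close>, when \<open>V\<close> is not trivial.\<close>

definition prime_split :: "int \<Rightarrow> nat \<Rightarrow> 'a set \<Rightarrow> bool" where
  "prime_split p N V \<longleftrightarrow> subgroup V G \<and> V \<subseteq> ppart p \<and> ppart p \<subseteq> V <#> tors (p ^ N) \<and> (V = {\<one>} \<or> full_exponent p N V)"

text \<open>On the elements of \<open>V\<close> killed by \<open>p^n\<close>, \<open>g\<close> is raising to a fixed power, prime to \<open>p\<close>. For varying \<open>n\<close> this is
  the action of a \<open>p\<close>-adic unit, but no compatibility of the exponents is needed.\<close>

definition scalar_on :: "int \<Rightarrow> 'a set \<Rightarrow> ('a \<Rightarrow> 'a) \<Rightarrow> bool" where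
  "scalar_on p V g \<longleftrightarrow> (\<forall>n::nat. \<exists>k::int. \<not> p dvd k \<and> (\<forall>x\<in>V \<inter> tors (p ^ n). g x = x [^] k))"

lemma soc_antimono: "m \<le> n \<Longrightarrow> soc p n \<subseteq> soc p m"
proof
  fix x assume mn: "m \<le> n" and "x \<in> soc p n"
  then obtain y where y: "x \<in> tors p" "y \<in> carrier G" "y [^] (p ^ n) = x" by (auto simp: soc_def)
  then have "(y [^] (p ^ (n - m))) [^] (p ^ m) = x" using mn by (simp add: int_pow_pow flip: power_add)
  then show "x \<in> soc p m" using y by (auto simp: soc_def)
qed

text \<open>The sets \<open>soc p m\<close> decrease, so they are constant from some \<open>N\<close> on if one of them is finite. Then the \<open>p^N\<close>-th powers
  in the \<open>p\<close>-part form a divisible subgroup \<open>V\<close>.\<close>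

lemma inertial_prime_split_finite_soc:
  fixes p :: int
  assumes p: "Factorial_Ring.prime p" and fin: "finite (soc p n)"
    and J: "\<And>\<gamma>. \<gamma> \<in> J \<Longrightarrow> inertial \<gamma>"
  shows "\<exists>N V. prime_split p N V \<and> (\<forall>\<gamma>\<in>J. scalar_on p V \<gamma>)"
proof -
  define N where "N = (ARG_MIN (\<lambda>m. card (soc p m)) m. m \<ge> n)"
  have N: "N \<ge> n" and Nmin: "\<And>m. m \<ge> n \<Longrightarrow> card (soc p N) \<le> card (soc p m)"
    using arg_min_nat_lemma[of "\<lambda>m. m \<ge> n" n "\<lambda>m. card (soc p m)"] unfolding N_def by auto
  have fN: "finite (soc p N)" using soc_antimono[OF N] fin finite_subset by blast
  have soc_eq: "soc p m = soc p N" if "m \<ge> N" for m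
    using card_seteq[OF fN soc_antimono[OF that]] Nmin[of m] that N by auto
  define V where "V = (\<lambda>y. y [^] (p ^ N)) ` ppart p"
  have pc: "y \<in> carrier G" if "y \<in> ppart p" for y using that by (simp add: ppart_def)
  have V: "subgroup V G"
  proof (rule subgroupI)
    show "V \<subseteq> carrier G" using pc by (auto simp: V_def)
    show "V \<noteq> {}" using subgroup.one_closed[OF subgroup_ppart] by (auto simp: V_def)
    show "inv a \<in> V" if "a \<in> V" for a
    proof -
      obtain y where y: "y \<in> ppart p" "a = y [^] (p ^ N)" using \<open>a \<in> V\<close> by (auto simp: V_def)
      then have "inv a = (inv y) [^] (p ^ N)" using pc by (simp add: int_pow_inv)
      then show ?thesis using subgroup.m_inv_closed[OF subgroup_ppart y(1)] by (auto simp: V_def)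
    qed
    show "a \<otimes> b \<in> V" if ab: "a \<in> V" "b \<in> V" for a b
    proof -
      obtain y z where y: "y \<in> ppart p" "a = y [^] (p ^ N)" "z \<in> ppart p" "b = z [^] (p ^ N)"
        using ab by (auto simp: V_def)
      then have "a \<otimes> b = (y \<otimes> z) [^] (p ^ N)" using pc by (simp add: int_pow_distrib)
      then show ?thesis using subgroup.m_closed[OF subgroup_ppart y(1,3)] by (auto simp: V_def)
    qed
  qed
  have Vp: "V \<subseteq> ppart p" using subgroup_int_pow_closed[OF subgroup_ppart] by (auto simp: V_def)
  have Vc: "y \<in> carrier G" if "y \<in> V" for y using subgroup.mem_carrier[OF V that] .
  have divm: "\<exists>y\<in>V. y [^] p = x" if "x \<in> V" "x [^] (p ^ m) = \<one>" for x m
    using that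
  proof (induction m arbitrary: x)
    case 0
    then have "x = \<one>" using Vc by simp
    then show ?case using subgroup.one_closed[OF V] by (intro bexI[of _ \<one>]) auto
  next
    case (Suc m)
    note xc = Vc[OF Suc.prems(1)]
    obtain y where y: "y \<in> ppart p" "x = y [^] (p ^ N)" using Suc.prems(1) by (auto simp: V_def)
    have "x [^] (p ^ m) = y [^] (p ^ (m + N))" using y pc by (simp add: int_pow_pow power_add mult.commute)
    moreover have "(x [^] (p ^ m)) [^] p = \<one>" using Suc.prems(2) xc by (simp add: int_pow_pow mult.commute)
    ultimately have "x [^] (p ^ m) \<in> soc p (m + N)" using xc pc[OF y(1)] by (auto simp: soc_def tors_def)
    also have "soc p (m + N) = soc p (N + Suc m)" using soc_eq[of "m + N"] soc_eq[of "N + Suc m"] by simp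
    finally obtain w where w: "w \<in> carrier G" "w [^] (p ^ (N + Suc m)) = x [^] (p ^ m)" by (auto simp: soc_def)
    have "w [^] (p ^ (N + Suc m) * p) = \<one>"
      using w \<open>(x [^] (p ^ m)) [^] p = \<one>\<close> by (metis int_pow_pow)
    then have "w [^] (p ^ Suc (N + Suc m)) = \<one>" by (simp add: mult_ac)
    then have "w \<in> ppart p" unfolding ppart_def using w(1) by blast
    define v where "v = w [^] (p ^ N)"
    have v: "v \<in> V" using \<open>w \<in> ppart p\<close> by (auto simp: V_def v_def)
    have vx: "(v [^] p) [^] (p ^ m) = x [^] (p ^ m)" using w by (simp add: v_def int_pow_pow power_add mult_ac)
    define x' where "x' = x \<otimes> inv (v [^] p)"
    have "x' \<in> V" unfolding x'_def
      using subgroup.m_closed[OF V Suc.prems(1) subgroup.m_inv_closed[OF V subgroup_int_pow_closed[OF V v]]] .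
    moreover have "x' [^] (p ^ m) = \<one>"
      using vx xc Vc[OF v] by (simp add: x'_def int_pow_distrib int_pow_inv)
    ultimately obtain y' where y': "y' \<in> V" "y' [^] p = x'" using Suc.IH by blast
    have "(y' \<otimes> v) [^] p = x' \<otimes> v [^] p" using y' Vc v by (simp add: int_pow_distrib)
    also have "\<dots> = x" using xc Vc[OF v] by (simp add: x'_def m_assoc)
    finally show ?case using subgroup.m_closed[OF V y'(1) v] by blast
  qed
  have div: "\<exists>y\<in>V. y [^] p = x" if "x \<in> V" for x
    using divm[OF that] that Vp by (auto simp: ppart_def)
  have divn: "\<exists>y\<in>V. y [^] (p ^ m) = x" if "x \<in> V" for x m
    using that
  proof (induction m arbitrary: x)
    case 0
    then show ?case using Vc by (intro bexI[of _ x]) auto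
  next
    case (Suc m)
    obtain y where y: "y \<in> V" "y [^] p = x" using div Suc.prems by blast
    obtain z where z: "z \<in> V" "z [^] (p ^ m) = y" using Suc.IH y by blast
    then have "z [^] (p ^ Suc m) = x" using y Vc by (metis int_pow_pow power_Suc2)
    then show ?case using z by blast
  qed
  have "ppart p \<subseteq> V <#> tors (p ^ N)"
  proof
    fix x assume x: "x \<in> ppart p"
    then have "x [^] (p ^ N) \<in> V" by (auto simp: V_def)
    then obtain d where d: "d \<in> V" "d [^] (p ^ N) = x [^] (p ^ N)" using divn by blast
    note c = pc[OF x] Vc[OF d(1)]
    have "inv d \<otimes> x \<in> tors (p ^ N)" using c d by (simp add: tors_def int_pow_distrib int_pow_inv)
    moreover have "d \<otimes> (inv d \<otimes> x) = x" using c by (simp flip: m_assoc)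
    ultimately show "x \<in> V <#> tors (p ^ N)" using set_multI[OF d(1)] by metis
  qed
  moreover have "V = {\<one>} \<or> full_exponent p N V"
  proof (cases "\<exists>m. V \<subseteq> tors (p ^ m)")
    case True
    then obtain m where m: "V \<subseteq> tors (p ^ m)" by blast
    have "x = \<one>" if "x \<in> V" for x
      using divn[OF that, of m] m by (auto simp: tors_def)
    then show ?thesis using subgroup.one_closed[OF V] by blast
  next
    case False
    then show ?thesis using unbounded_full_exponent[OF p V Vp] by blast
  qed
  ultimately have "prime_split p N V" using V Vp by (simp add: prime_split_def)
  moreover have "scalar_on p V \<gamma>" if \<gamma>: "\<gamma> \<in> J" for \<gamma>
    unfolding scalar_on_def
  proof
    fix m :: nat
    note in\<gamma> = inertialD[OF J[OF \<gamma>]]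
    obtain k where k: "\<forall>x \<in> V \<inter> tors (p ^ m). \<gamma> x = x [^] (k::int)"
      using power_endo_scalar[OF p V in\<gamma>(1) inertial_divisible[OF p J[OF \<gamma>] V Vp div]] by blast
    show "\<exists>k::int. \<not> p dvd k \<and> (\<forall>x\<in>V \<inter> tors (p ^ m). \<gamma> x = x [^] k)"
      by (rule scalar_coprime[OF p in\<gamma> subgroups_Inter_pair[OF V subgroup_tors]]) (use k Vp in auto)
  qed
  ultimately show ?thesis by blast
qed

lemma fin_idx_subset:
  assumes C: "fin_idx C E" "subgroup C G" and E: "E \<subseteq> carrier G" and D: "subgroup D G" "D \<subseteq> E"
  shows "fin_idx (C \<inter> D) D"
proof -
  obtain R f where R: "finite R" "R \<subseteq> E" and f: "\<And>x. x \<in> E \<Longrightarrow> f x \<in> R" "\<And>x. x \<in> E \<Longrightarrow> x \<otimes> inv (f x) \<in> C"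
    using fin_idxE[OF C(1)] by metis
  show ?thesis
  proof (rule fin_idxI[of f])
    show "finite (f ` D)" using R(1) f(1) D(2) by (meson finite_subset image_subsetI subsetD)
    fix x y assume xy: "x \<in> D" "y \<in> D" "f x = f y"
    have E': "x \<in> E" "y \<in> E" using xy D(2) by auto
    have c: "x \<in> carrier G" "y \<in> carrier G" "f y \<in> carrier G" using E' E R(2) f(1) by auto
    have "(x \<otimes> inv (f y)) \<otimes> inv (y \<otimes> inv (f y)) = x \<otimes> inv y \<otimes> (inv (f y) \<otimes> f y)"
      using c by (simp only: inv_mult inv_closed inv_inv m_ac m_closed)
    then have "x \<otimes> inv y = (x \<otimes> inv (f y)) \<otimes> inv (y \<otimes> inv (f y))" using c by simp
    also have "\<dots> \<in> C"
      using f(2)[OF E'(1)] f(2)[OF E'(2)] xy(3) subgroup.m_closed[OF C(2) _ subgroup.m_inv_closed[OF C(2)]] by auto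
    finally show "x \<otimes> inv y \<in> C \<inter> D"
      using subgroup.m_closed[OF D(1) xy(1) subgroup.m_inv_closed[OF D(1) xy(2)]] by blast
  qed
qed

lemma pow_hom: "(\<lambda>x. x [^] (k::int)) \<in> hom G G"
  by (rule homI) (auto simp: int_pow_distrib)

text \<open>The \<open>p^n\<close>-th powers of the elements killed by \<open>p^(n+1)\<close> contain \<open>soc p n\<close>, so they stay infinite on passing to a subgroup of finite index.\<close>

lemma infinite_soc_witness:
  fixes p :: int
  assumes inf: "infinite (soc p n)" and D: "subgroup D G" "fin_idx D (tors (p ^ Suc n))" and T: "finite T"
  shows "\<exists>c\<in>D. c [^] (p ^ n) \<notin> T"
proof (rule ccontr)
  assume "\<not> ?thesis"
  then have "(\<lambda>c. c [^] (p ^ n)) ` D \<subseteq> T" by blast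
  then have "finite ((\<lambda>c. c [^] (p ^ n)) ` D)" using T finite_subset by blast
  then have "finite ((\<lambda>c. c [^] (p ^ n)) ` tors (p ^ Suc n))"
    by (rule fin_idx_image_finite[OF pow_hom subgroup.subset[OF subgroup_tors] D(2,1)])
  moreover have "soc p n \<subseteq> (\<lambda>c. c [^] (p ^ n)) ` tors (p ^ Suc n)"
  proof
    fix x assume "x \<in> soc p n"
    then obtain y where y: "x [^] p = \<one>" "y \<in> carrier G" "x = y [^] (p ^ n)" by (auto simp: soc_def tors_def)
    then have "y \<in> tors (p ^ Suc n)" by (simp add: tors_def int_pow_pow mult.commute)
    then show "x \<in> (\<lambda>c. c [^] (p ^ n)) ` tors (p ^ Suc n)" using y by blast
  qed
  ultimately show False using inf finite_subset by blast
qed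

text \<open>Each \<open>n\<close> gives an exponent \<open>k n\<close> and a subgroup \<open>C n\<close> of finite index in \<open>A[p\<^sup>n]\<close> on which \<open>\<gamma>\<close> is that power. Elements of
  order \<open>p^n\<close> in \<open>C n \<inter> C m\<close> show that the exponents are coherent. The deviation of \<open>\<gamma>\<close> from the resulting map has
  values in \<open>T\<close>: multiply a given \<open>x\<close> by an element \<open>c\<close> of larger order without deviation, chosen such that
  \<open>\<langle>x c\<rangle>\<close> avoids \<open>T\<close> and the deviation of \<open>x\<close>.\<close>

lemma inertial_infinite_soc:
  fixes p :: int
  assumes p: "Factorial_Ring.prime p" and \<gamma>: "inertial \<gamma>" and inf: "\<And>n. infinite (soc p n)"
  shows "\<exists>V. subgroup V G \<and> V \<subseteq> ppart p \<and> fin_idx V (ppart p) \<and>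
    (\<forall>n. \<exists>k::int. \<forall>x\<in>V \<inter> tors (p ^ n). \<gamma> x = x [^] k)"
proof -
  note hom = inertialD(1)[OF \<gamma>]
  obtain T where T: "subgroup T G" "finite T"
    and key: "\<And>x. \<lbrakk>x \<in> carrier G; \<And>k::int. x [^] k \<in> T \<Longrightarrow> x [^] k = \<one>\<rbrakk> \<Longrightarrow> \<exists>k::int. \<gamma> x \<otimes> inv (x [^] k) \<in> T"
    using inertial_finite_subgroup[OF \<gamma>] by blast
  have "\<forall>n. \<exists>kC. subgroup (snd kC) G \<and> snd kC \<subseteq> tors (p ^ n) \<and> fin_idx (snd kC) (tors (p ^ n)) \<and> (\<forall>x\<in>snd kC. \<gamma> x = x [^] (fst kC :: int))"
  proof
    fix n
    obtain F C where C: "subgroup C G" "C \<subseteq> tors (p ^ n)" "fin_idx C (tors (p ^ n))" "almost_scalar p n F C \<gamma>"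
      using inertial_almost_scalar[OF p \<gamma>, of n] by auto
    then obtain k :: int where "\<forall>x\<in>C. \<gamma> x = x [^] k" unfolding almost_scalar_def by blast
    then show "\<exists>kC. subgroup (snd kC) G \<and> snd kC \<subseteq> tors (p ^ n) \<and> fin_idx (snd kC) (tors (p ^ n)) \<and> (\<forall>x\<in>snd kC. \<gamma> x = x [^] (fst kC :: int))"
      using C by (intro exI[of _ "(k, C)"]) simp
  qed
  from choice[OF this] obtain kC where kC: "\<And>n. subgroup (snd (kC n)) G" "\<And>n. snd (kC n) \<subseteq> tors (p ^ n)"
    "\<And>n. fin_idx (snd (kC n)) (tors (p ^ n))" "\<And>n x. x \<in> snd (kC n) \<Longrightarrow> \<gamma> x = x [^] (fst (kC n) :: int)" by blast
  define k where "k n = fst (kC n)" for n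
  define C where "C n = snd (kC n)" for n
  have C: "subgroup (C n) G" "C n \<subseteq> tors (p ^ n)" "fin_idx (C n) (tors (p ^ n))" "\<And>x. x \<in> C n \<Longrightarrow> \<gamma> x = x [^] k n" for n
    using kC unfolding k_def C_def by auto
  have tc: "tors a \<subseteq> carrier G" for a by (auto simp: tors_def)
  have coh_le: "p ^ n dvd k n - k m" if nm: "n \<le> m" for n m
  proof (cases n)
    case (Suc n')
    have sub: "tors (p ^ n) \<subseteq> tors (p ^ m)" using nm by (intro tors_mono le_imp_power_dvd)
    define D where "D = C n \<inter> (C m \<inter> tors (p ^ n))"
    have Dm: "subgroup (C m \<inter> tors (p ^ n)) G" using subgroups_Inter_pair[OF C(1) subgroup_tors] .
    have "subgroup D G" unfolding D_def using subgroups_Inter_pair[OF C(1) Dm] .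
    moreover have "fin_idx D (tors (p ^ Suc n'))"
      unfolding D_def Suc[symmetric]
      by (rule fin_idx_Int[OF C(1,3) Dm fin_idx_subset[OF C(3,1) tc subgroup_tors sub] tc])
    ultimately obtain c where c: "c \<in> D" "c [^] (p ^ n') \<notin> {\<one>}"
      using infinite_soc_witness[OF inf] by blast
    have cc: "c \<in> carrier G" "c [^] (p ^ Suc n') = \<one>" using c(1) Suc by (auto simp: D_def tors_def)
    have "c [^] k n = c [^] k m" using c(1) C(4)[of c n] C(4)[of c m] by (simp add: D_def)
    then have "c [^] (k n - k m) = \<one>" using cc by (simp add: int_pow_diff)
    then show ?thesis using prime_power_order[OF p cc] c(2) Suc by blast
  qed simp
  have coh: "x [^] k n = x [^] k m" if x: "x \<in> tors (p ^ n)" "x \<in> tors (p ^ m)" for x n m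
  proof -
    have "x [^] k a = x [^] k b" if "a \<le> b" "x \<in> tors (p ^ a)" for a b
      using int_pow_one_dvd[OF _ _ coh_le[OF that(1)], of x] that(2)
      by (simp add: tors_def int_pow_diff right_divide_eq_iff)
    then show ?thesis using x by (metis linear)
  qed
  have dT: "defect \<gamma> (k m) x \<in> T" if x: "x \<in> tors (p ^ m)" for x m
  proof (rule ccontr)
    assume nT: "defect \<gamma> (k m) x \<notin> T"
    let ?y = "defect \<gamma> (k m) x"
    have xc: "x \<in> carrier G" using x tc by blast
    have yc: "?y \<in> carrier G" using hom_in_carrier[OF defect_hom[OF hom] xc] .
    obtain T' where T': "subgroup T' G" "finite T'" "T \<subseteq> T'" "?y \<in> T'"
      using finite_subgroup_extend[OF T yc] by blast
    obtain c where c: "c \<in> C (Suc m)" "c [^] (p ^ m) \<notin> T'"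
      using infinite_soc_witness[OF inf C(1) C(3) T'(2)] by blast
    have ct: "c \<in> tors (p ^ Suc m)" using c C(2) by blast
    have cc: "c \<in> carrier G" using ct tc by blast
    have xt: "x \<in> tors (p ^ Suc m)" using x tors_mono[of "p ^ m" "p ^ Suc m"] by auto
    define z where "z = x \<otimes> c"
    have zc: "z \<in> carrier G" using xc cc by (simp add: z_def)
    have "z \<in> tors (p ^ Suc m)" unfolding z_def using subgroup.m_closed[OF subgroup_tors xt ct] .
    then have z1: "z [^] (p ^ Suc m) = \<one>" by (simp add: tors_def)
    have "x [^] (p ^ m) = \<one>" using x by (simp add: tors_def)
    then have z2: "z [^] (p ^ m) \<notin> T'" using c(2) xc cc by (simp add: z_def int_pow_distrib)
    have ztriv: "z [^] j = \<one>" if "z [^] j \<in> T'" for j :: int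
      by (rule powers_meet_trivial[OF p T'(1) zc z1 z2 that])
    obtain j where j: "\<gamma> z \<otimes> inv (z [^] (j::int)) \<in> T" using key[OF zc] ztriv T'(3) by blast
    let ?K = "k (Suc m)"
    have "defect \<gamma> ?K c = \<one>" using defect_one_iff[OF hom cc] C(4)[OF c(1)] by simp
    moreover have "defect \<gamma> ?K x = ?y" using coh[OF x xt] by (simp add: defect_def)
    ultimately have dz: "defect \<gamma> ?K z = ?y"
      using hom_mult[OF defect_hom[OF hom] xc cc] yc by (simp add: z_def)
    let ?t = "defect \<gamma> j z"
    have t: "?t \<in> T" using j by (simp add: defect_def)
    have tcr: "?t \<in> carrier G" using hom_in_carrier[OF defect_hom[OF hom] zc] .
    have "?t \<otimes> z [^] j = ?y \<otimes> z [^] ?K"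
      using defect_eq[OF hom zc, of j] defect_eq[OF hom zc, of ?K] dz by simp
    then have "z [^] j = inv ?t \<otimes> (?y \<otimes> z [^] ?K)" using tcr zc yc by (metis inv_solve_left int_pow_closed m_closed)
    then have "z [^] j = (inv ?t \<otimes> ?y) \<otimes> z [^] ?K" using tcr zc yc by (simp add: m_assoc)
    then have zj: "z [^] (j - ?K) = inv ?t \<otimes> ?y"
      using tcr zc yc by (simp add: int_pow_diff right_divide_eq_iff)
    have "inv ?t \<otimes> ?y \<in> T'" using t T'(3,4) subgroup.m_closed[OF T'(1) subgroup.m_inv_closed[OF T'(1)]] by blast
    then have "z [^] (j - ?K) \<in> T'" using zj by simp
    then have "z [^] (j - ?K) = \<one>" by (rule ztriv)
    then have "?y = ?t" using zj tcr yc by (metis inv_equality inv_inv m_comm inv_closed)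
    then show False using t nT by simp
  qed
  define V where "V = {x \<in> ppart p. \<forall>n. x \<in> tors (p ^ n) \<longrightarrow> \<gamma> x = x [^] k n}"
  have Vp: "V \<subseteq> ppart p" by (auto simp: V_def)
  have VI: "x \<in> V" if x: "x \<in> tors (p ^ n)" "defect \<gamma> (k n) x = \<one>" for x n
  proof -
    have "\<gamma> x = x [^] k n" using x(2) defect_one_iff[OF hom tors_carrier[OF x(1)]] by blast
    then have "\<gamma> x = x [^] k m" if "x \<in> tors (p ^ m)" for m using coh[OF x(1) that] by simp
    then show ?thesis unfolding V_def using x(1) tors_ppart by blast
  qed
  have VD: "defect \<gamma> (k n) x = \<one>" if x: "x \<in> V" "x \<in> tors (p ^ n)" for x n
    using x defect_one_iff[OF hom tors_carrier[OF x(2)]] unfolding V_def by blast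
  have V: "subgroup V G"
  proof (rule subgroupI)
    show "V \<subseteq> carrier G" by (auto simp: V_def ppart_def)
    have "\<one> \<in> V" by (rule VI[of _ 0]) (use hom_one[OF defect_hom[OF hom] is_group is_group] in \<open>auto simp: tors_def\<close>)
    then show "V \<noteq> {}" by blast
    show "inv a \<in> V" if a: "a \<in> V" for a
    proof -
      obtain n where n: "a \<in> tors (p ^ n)" using a Vp by (auto simp: ppart_def tors_def)
      have ac: "a \<in> carrier G" using n tc by blast
      show ?thesis
        by (rule VI[OF subgroup.m_inv_closed[OF subgroup_tors n]])
          (use VD[OF a n] hom_m_inv[OF defect_hom[OF hom] ac] in simp)
    qed
    show "a \<otimes> b \<in> V" if ab: "a \<in> V" "b \<in> V" for a b
    proof -
      obtain n where n: "a \<in> tors (p ^ n)" "b \<in> tors (p ^ n)" using ppart_common ab Vp by blast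
      have c: "a \<in> carrier G" "b \<in> carrier G" using n tc by auto
      show ?thesis
        by (rule VI[OF subgroup.m_closed[OF subgroup_tors n]])
          (use VD[OF ab(1) n(1)] VD[OF ab(2) n(2)] hom_mult[OF defect_hom[OF hom] c] in simp)
    qed
  qed
  define lev where "lev x = (SOME n. x \<in> tors (p ^ n))" for x
  have lev: "x \<in> tors (p ^ lev x)" if "x \<in> ppart p" for x
    unfolding lev_def by (rule someI_ex) (use that in \<open>auto simp: ppart_def tors_def\<close>)
  have dlev: "defect \<gamma> (k (lev x)) x = defect \<gamma> (k n) x" if "x \<in> tors (p ^ n)" for x n
    using coh[OF lev[OF subsetD[OF tors_ppart that]] that] by (simp add: defect_def)
  have "fin_idx V (ppart p)"
  proof (rule fin_idxI[of "\<lambda>x. defect \<gamma> (k (lev x)) x"])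
    have "(\<lambda>x. defect \<gamma> (k (lev x)) x) ` ppart p \<subseteq> T" using dT lev by blast
    then show "finite ((\<lambda>x. defect \<gamma> (k (lev x)) x) ` ppart p)" using T(2) finite_subset by blast
    fix x y assume xy: "x \<in> ppart p" "y \<in> ppart p" and eq: "defect \<gamma> (k (lev x)) x = defect \<gamma> (k (lev y)) y"
    obtain n where n: "x \<in> tors (p ^ n)" "y \<in> tors (p ^ n)" using ppart_common[OF xy] .
    have c: "x \<in> carrier G" "y \<in> carrier G" using n tc by auto
    have "defect \<gamma> (k n) x = defect \<gamma> (k n) y" using eq dlev[OF n(1)] dlev[OF n(2)] by simp
    moreover have "defect \<gamma> (k n) (x \<otimes> inv y) = defect \<gamma> (k n) x \<otimes> inv (defect \<gamma> (k n) y)"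
      using hom_mult[OF defect_hom[OF hom], of x "inv y"] hom_m_inv[OF defect_hom[OF hom] c(2)] c by simp
    ultimately have "defect \<gamma> (k n) (x \<otimes> inv y) = \<one>" using hom_in_carrier[OF defect_hom[OF hom] c(2)] by simp
    then show "x \<otimes> inv y \<in> V"
      by (rule VI[OF subgroup.m_closed[OF subgroup_tors n(1) subgroup.m_inv_closed[OF subgroup_tors n(2)]]])
  qed
  moreover have "\<forall>n. \<exists>k::int. \<forall>x\<in>V \<inter> tors (p ^ n). \<gamma> x = x [^] k" by (auto simp: V_def)
  ultimately show ?thesis using V Vp by blast
qed

lemma inertial_prime_split_infinite_soc:
  fixes p :: int
  assumes p: "Factorial_Ring.prime p" and inf: "\<And>n. infinite (soc p n)"
    and J: "finite J" "\<And>\<gamma>. \<gamma> \<in> J \<Longrightarrow> inertial \<gamma>"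
  shows "\<exists>N V. prime_split p N V \<and> (\<forall>\<gamma>\<in>J. scalar_on p V \<gamma>)"
proof -
  have pc: "ppart p \<subseteq> carrier G" by (auto simp: ppart_def)
  have "\<exists>V. subgroup V G \<and> V \<subseteq> ppart p \<and> fin_idx V (ppart p) \<and>
      (\<forall>\<gamma>\<in>J. \<forall>n. \<exists>k::int. \<forall>x\<in>V \<inter> tors (p ^ n). \<gamma> x = x [^] k)"
    using J
  proof (induction J rule: finite_induct)
    case empty
    have "fin_idx (ppart p) (ppart p)"
      using subgroup.one_closed[OF subgroup_ppart] pc unfolding fin_idx_def by (intro exI[of _ "{\<one>}"]) auto
    then show ?case using subgroup_ppart by blast
  next
    case (insert \<gamma> J)
    then obtain V where V: "subgroup V G" "V \<subseteq> ppart p" "fin_idx V (ppart p)"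
      "\<forall>\<gamma>\<in>J. \<forall>n. \<exists>k::int. \<forall>x\<in>V \<inter> tors (p ^ n). \<gamma> x = x [^] k" by auto
    obtain W where W: "subgroup W G" "W \<subseteq> ppart p" "fin_idx W (ppart p)"
      "\<forall>n. \<exists>k::int. \<forall>x\<in>W \<inter> tors (p ^ n). \<gamma> x = x [^] k"
      using inertial_infinite_soc[OF p _ inf, of \<gamma>] insert by auto
    show ?case
    proof (intro exI[of _ "V \<inter> W"] conjI ballI allI)
      show "subgroup (V \<inter> W) G" using subgroups_Inter_pair[OF V(1) W(1)] .
      show "fin_idx (V \<inter> W) (ppart p)" using fin_idx_Int[OF V(1,3) W(1,3) pc] .
      show "\<exists>k::int. \<forall>x\<in>V \<inter> W \<inter> tors (p ^ n). \<delta> x = x [^] k" if \<delta>: "\<delta> \<in> insert \<gamma> J" for \<delta> n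
      proof (cases "\<delta> = \<gamma>")
        case True
        then show ?thesis using W(4)[rule_format, of n] by blast
      next
        case False
        then have "\<delta> \<in> J" using \<delta> by blast
        then show ?thesis using V(4)[rule_format, of \<delta> n] by blast
      qed
    qed (use V in blast)
  qed
  then obtain V where V: "subgroup V G" "V \<subseteq> ppart p" "fin_idx V (ppart p)"
    "\<And>\<gamma> n. \<gamma> \<in> J \<Longrightarrow> \<exists>k::int. \<forall>x\<in>V \<inter> tors (p ^ n). \<gamma> x = x [^] k" by blast
  obtain R f where R: "finite R" "R \<subseteq> ppart p"
    and f: "\<And>x. x \<in> ppart p \<Longrightarrow> f x \<in> R" "\<And>x. x \<in> ppart p \<Longrightarrow> x \<otimes> inv (f x) \<in> V"
    using fin_idxE[OF V(3)] by metis
  have "\<exists>N. R \<subseteq> tors (p ^ N)"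
    using R
  proof (induction R rule: finite_induct)
    case (insert x R)
    then obtain N where N: "R \<subseteq> tors (p ^ N)" by auto
    obtain n :: nat where n: "x \<in> tors (p ^ n)" using insert.prems by (auto simp: ppart_def tors_def)
    have "tors (p ^ N) \<subseteq> tors (p ^ (N + n))" "tors (p ^ n) \<subseteq> tors (p ^ (N + n))"
      by (intro tors_mono le_imp_power_dvd, simp)+
    then show ?case using N n by (intro exI[of _ "N + n"]) auto
  qed simp
  then obtain N where N: "R \<subseteq> tors (p ^ N)" by blast
  have dec: "x \<in> V <#> tors (p ^ N)" if x: "x \<in> ppart p" for x
  proof -
    have c: "x \<in> carrier G" "f x \<in> carrier G" using x f(1)[OF x] R(2) pc by auto
    have "(x \<otimes> inv (f x)) \<otimes> f x \<in> V <#> tors (p ^ N)" using set_multI[OF f(2)[OF x]] f(1)[OF x] N by blast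
    then show ?thesis using coset_factor[OF c] by simp
  qed
  have "\<not> V \<subseteq> tors (p ^ m)" for m
  proof
    assume m: "V \<subseteq> tors (p ^ m)"
    have sub: "tors (p ^ N) \<subseteq> tors (p ^ (N + m))" "tors (p ^ m) \<subseteq> tors (p ^ (N + m))"
      by (intro tors_mono le_imp_power_dvd, simp)+
    have all: "x \<in> tors (p ^ (N + m))" if x: "x \<in> ppart p" for x
    proof -
      obtain v e where ve: "v \<in> V" "e \<in> tors (p ^ N)" "x = v \<otimes> e" using dec[OF x] by (rule set_multE)
      then have "v \<in> tors (p ^ (N + m))" "e \<in> tors (p ^ (N + m))" using m sub by auto
      then show ?thesis using subgroup.m_closed[OF subgroup_tors] ve(3) by blast
    qed
    have "soc p (N + m) \<subseteq> {\<one>}"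
    proof
      fix x assume "x \<in> soc p (N + m)"
      then obtain y where y: "y \<in> carrier G" "x = y [^] (p ^ (N + m))" "x [^] p = \<one>"
        by (auto simp: soc_def tors_def)
      then have "y [^] (p ^ Suc (N + m)) = \<one>" by (simp add: int_pow_pow mult.commute)
      then have "y \<in> ppart p" unfolding ppart_def using y(1) by blast
      then show "x \<in> {\<one>}" using all y(2) by (auto simp: tors_def)
    qed
    then show False using inf[of "N + m"] finite_subset by blast
  qed
  then have "prime_split p N V" using unbounded_full_exponent[OF p V(1,2)] V(1,2) dec by (auto simp: prime_split_def)
  moreover have "scalar_on p V \<gamma>" if \<gamma>: "\<gamma> \<in> J" for \<gamma>
    unfolding scalar_on_def
  proof
    fix m :: nat
    obtain k where k: "\<forall>x \<in> V \<inter> tors (p ^ m). \<gamma> x = x [^] (k::int)" using V(4)[OF \<gamma>] by blast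
    show "\<exists>k::int. \<not> p dvd k \<and> (\<forall>x\<in>V \<inter> tors (p ^ m). \<gamma> x = x [^] k)"
      by (rule scalar_coprime[OF p inertialD[OF J(2)[OF \<gamma>]] subgroups_Inter_pair[OF V(1) subgroup_tors]])
        (use k V(2) in auto)
  qed
  ultimately show ?thesis by blast
qed

lemma inertial_prime_split:
  fixes p :: int
  assumes "Factorial_Ring.prime p" "finite J" "\<And>\<gamma>. \<gamma> \<in> J \<Longrightarrow> inertial \<gamma>"
  shows "\<exists>N V. prime_split p N V \<and> (\<forall>\<gamma>\<in>J. scalar_on p V \<gamma>)"
  using inertial_prime_split_infinite_soc[OF assms(1) _ assms(2,3)] inertial_prime_split_finite_soc[OF assms(1) _ assms(3)] by metis

text \<open>The exceptional primes are the divisors of the orders of the finite subgroups that belong to the elements of \<open>J\<close>.\<close>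

lemma inertial_almost_all_primes:
  assumes J: "finite J" "\<And>\<gamma>. \<gamma> \<in> J \<Longrightarrow> inertial \<gamma>"
  shows "\<exists>P::int set. finite P \<and> (\<forall>p. Factorial_Ring.prime p \<longrightarrow> p \<notin> P \<longrightarrow> prime_split p 0 (ppart p) \<and> (\<forall>\<gamma>\<in>J. scalar_on p (ppart p) \<gamma>))"
proof -
  have spl: "prime_split p 0 (ppart p)" for p
    using subgroup_ppart set_multI[of _ "ppart p" \<one> "tors 1"]
    by (auto simp: prime_split_def full_exponent_def tors_def ppart_def)
  have "\<exists>P::int set. finite P \<and> (\<forall>p. Factorial_Ring.prime p \<longrightarrow> p \<notin> P \<longrightarrow> scalar_on p (ppart p) \<gamma>)" if \<gamma>: "inertial \<gamma>" for \<gamma>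
  proof -
    note hom = inertialD(1)[OF \<gamma>]
    obtain T where T: "subgroup T G" "finite T"
      and key: "\<And>x. \<lbrakk>x \<in> carrier G; \<And>k::int. x [^] k \<in> T \<Longrightarrow> x [^] k = \<one>\<rbrakk> \<Longrightarrow> \<exists>k::int. \<gamma> x \<otimes> inv (x [^] k) \<in> T"
      using inertial_finite_subgroup[OF \<gamma>] by blast
    have cT: "card T > 0" using T subgroup.one_closed[OF T(1)] by (auto simp: card_gt_0_iff)
    have tT: "t [^] int (card T) = \<one>" if "t \<in> T" for t
    proof -
      interpret S: group "G\<lparr>carrier := T\<rparr>" using subgroup.subgroup_is_group[OF T(1) is_group] .
      have "t [^]\<^bsub>G\<lparr>carrier := T\<rparr>\<^esub> order (G\<lparr>carrier := T\<rparr>) = \<one>\<^bsub>G\<lparr>carrier := T\<rparr>\<^esub>"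
        by (rule S.pow_order_eq_1) (use that in simp)
      then show ?thesis by (simp add: order_def int_pow_int flip: nat_pow_consistent)
    qed
    have "scalar_on p (ppart p) \<gamma>" if p: "Factorial_Ring.prime p" "\<not> p dvd int (card T)" for p
    proof -
      have triv: "t = \<one>" if t: "t \<in> T" "t \<in> ppart p" for t
      proof -
        obtain n :: nat where n: "t \<in> carrier G" "t [^] (p ^ n) = \<one>" using t(2) by (auto simp: ppart_def)
        have "coprime (p ^ n) (int (card T))" using p by (simp add: prime_imp_coprime)
        then show ?thesis using int_pow_one_coprime[OF n tT[OF t(1)]] by blast
      qed
      have pow: "\<exists>k::int. \<gamma> z = z [^] k" if z: "z \<in> ppart p" for z
      proof -
        have zc: "z \<in> carrier G" using z by (simp add: ppart_def)
        obtain n where n: "z \<in> tors (p ^ n)" using z by (auto simp: ppart_def tors_def)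
        obtain k where k: "\<gamma> z \<otimes> inv (z [^] (k::int)) \<in> T"
          using key[OF zc] triv subgroup_int_pow_closed[OF subgroup_ppart z] by blast
        have "\<gamma> z \<in> ppart p" using hom_tors[OF hom n] tors_ppart by blast
        then have "\<gamma> z \<otimes> inv (z [^] k) \<in> ppart p"
          using subgroup.m_closed[OF subgroup_ppart _ subgroup.m_inv_closed[OF subgroup_ppart subgroup_int_pow_closed[OF subgroup_ppart z]]] by blast
        then have "defect \<gamma> k z = \<one>" using triv k by (simp add: defect_def)
        then show ?thesis using defect_one_iff[OF hom zc] by blast
      qed
      show ?thesis
        unfolding scalar_on_def
      proof
        fix m :: nat
        obtain k where k: "\<forall>x \<in> ppart p \<inter> tors (p ^ m). \<gamma> x = x [^] (k::int)"
          using power_endo_scalar[OF p(1) subgroup_ppart hom pow] by blast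
        show "\<exists>k::int. \<not> p dvd k \<and> (\<forall>x\<in>ppart p \<inter> tors (p ^ m). \<gamma> x = x [^] k)"
          by (rule scalar_coprime[OF p(1) inertialD[OF \<gamma>] subgroups_Inter_pair[OF subgroup_ppart subgroup_tors]])
            (use k in auto)
      qed
    qed
    moreover have "finite {p. p dvd int (card T)}" using cT by (intro finite_divisors_int) simp
    ultimately show ?thesis by (intro exI[of _ "{p. p dvd int (card T)}"]) auto
  qed
  then have "\<forall>\<gamma>\<in>J. \<exists>P::int set. finite P \<and> (\<forall>p. Factorial_Ring.prime p \<longrightarrow> p \<notin> P \<longrightarrow> scalar_on p (ppart p) \<gamma>)"
    using J(2) by blast
  from bchoice[OF this] obtain P where P: "\<And>\<gamma>. \<gamma> \<in> J \<Longrightarrow> finite (P \<gamma> :: int set)"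
    "\<And>\<gamma> p. \<lbrakk>\<gamma> \<in> J; Factorial_Ring.prime p; p \<notin> P \<gamma>\<rbrakk> \<Longrightarrow> scalar_on p (ppart p) \<gamma>" by blast
  show ?thesis using P J(1) spl by (intro exI[of _ "\<Union>\<gamma>\<in>J. P \<gamma>"]) auto
qed

section \<open>Central automorphisms\<close>

lemma scalar_on_generate:
  fixes p :: int
  assumes p: "Factorial_Ring.prime p" and V: "subgroup V G"
    and J: "J \<subseteq> auto G" "\<And>\<gamma>. \<gamma> \<in> J \<Longrightarrow> scalar_on p V \<gamma>" and g: "g \<in> generate (AutoGroup G) J"
  shows "scalar_on p V g"
proof -
  \<comment> \<open>With \<open>F = tors (p ^ n)\<close> the condition on the deviation is void.\<close>
  have "almost_scalar p n (tors (p ^ n)) (V \<inter> tors (p ^ n)) g" for n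
  proof (rule almost_scalar_generate[OF p subgroup_tors subgroups_Inter_pair[OF V subgroup_tors] _ J(1) _ g])
    fix \<gamma> assume \<gamma>: "\<gamma> \<in> J"
    have hom: "\<gamma> \<in> hom G G" using autoD(1) J(1) \<gamma> by blast
    have "defect \<gamma> k x \<in> tors (p ^ n)" if x: "x \<in> tors (p ^ n)" for k x
      by (rule hom_tors[OF defect_hom[OF hom] x])
    moreover obtain k :: int where "\<not> p dvd k" "\<forall>x\<in>V \<inter> tors (p ^ n). \<gamma> x = x [^] k"
      using J(2)[OF \<gamma>] unfolding scalar_on_def by blast
    ultimately show "almost_scalar p n (tors (p ^ n)) (V \<inter> tors (p ^ n)) \<gamma>"
      unfolding almost_scalar_def by blast
  qed blast
  then show ?thesis unfolding almost_scalar_def scalar_on_def by blast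
qed

lemma prime_split_scalar:
  fixes p :: int
  assumes spl: "prime_split p N V" and u: "u \<in> hom G G" and sc: "scalar_on p V u"
    and fix_tors: "\<And>x. x \<in> tors (p ^ N) \<Longrightarrow> u x = x"
  shows "\<exists>k::int. \<forall>x\<in>tors (p ^ n). u x = x [^] k"
proof -
  have V: "subgroup V G" "V = {\<one>} \<or> full_exponent p N V" using spl by (auto simp: prime_split_def)
  have sub: "tors (p ^ N) \<subseteq> tors (p ^ (N + n))" "tors (p ^ n) \<subseteq> tors (p ^ (N + n))"
    by (intro tors_mono le_imp_power_dvd, simp)+
  obtain k0 :: int where k0: "\<And>x. x \<in> V \<inter> tors (p ^ (N + n)) \<Longrightarrow> u x = x [^] k0"
    using sc unfolding scalar_on_def by metis
  have "\<exists>k::int. (\<forall>x \<in> V \<inter> tors (p ^ (N + n)). u x = x [^] k) \<and> (\<forall>x\<in>tors (p ^ N). x [^] k = x)"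
    using V(2)
  proof
    assume "V = {\<one>}"
    then show ?thesis using hom_one[OF u is_group is_group] tors_carrier by (intro exI[of _ 1]) auto
  next
    assume full_exponent: "full_exponent p N V"
    have "x [^] (k0 - 1) = \<one>" if x: "x \<in> V \<inter> tors (p ^ N)" for x
    proof -
      have "x [^] k0 = x" using k0[of x] fix_tors[of x] x sub(1) by auto
      moreover have "x \<in> carrier G" using x tors_carrier by blast
      ultimately show ?thesis by (simp add: int_pow_diff)
    qed
    then have d: "p ^ N dvd k0 - 1" using full_exponent unfolding full_exponent_def by blast
    have "x [^] k0 = x" if x: "x \<in> tors (p ^ N)" for x
    proof -
      note xc = tors_carrier[OF x]
      have "x [^] (k0 - 1) = \<one>" using int_pow_one_dvd[OF xc _ d] x by (simp add: tors_def)
      then show ?thesis using xc by (simp add: int_pow_diff right_divide_eq_iff)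
    qed
    then show ?thesis using k0 by blast
  qed
  then obtain k :: int where k: "\<And>x. x \<in> V \<inter> tors (p ^ (N + n)) \<Longrightarrow> u x = x [^] k" "\<And>x. x \<in> tors (p ^ N) \<Longrightarrow> x [^] k = x"
    by blast
  have "u x = x [^] k" if x: "x \<in> tors (p ^ n)" for x
  proof -
    have "x \<in> V <#> tors (p ^ N)" using spl x tors_ppart unfolding prime_split_def by blast
    then obtain d e where de: "d \<in> V" "e \<in> tors (p ^ N)" "x = d \<otimes> e" by (rule set_multE)
    have c: "d \<in> carrier G" "e \<in> carrier G" "x \<in> carrier G"
      using subgroup.mem_carrier[OF V(1) de(1)] tors_carrier de(2) x by auto
    have "x \<otimes> inv e \<in> tors (p ^ (N + n))"
      using subgroup.m_closed[OF subgroup_tors _ subgroup.m_inv_closed[OF subgroup_tors]] x de(2) sub by blast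
    then have "d \<in> V \<inter> tors (p ^ (N + n))" using de c by (simp add: m_assoc)
    then have "u x = d [^] k \<otimes> e" using hom_mult[OF u c(1,2)] k(1) fix_tors[OF de(2)] de(3) by simp
    also have "\<dots> = x [^] k" using k(2)[OF de(2)] c de(3) by (simp add: int_pow_distrib)
    finally show ?thesis .
  qed
  then show ?thesis by blast
qed

lemma carrier_prime_power_generated:
  assumes W: "subgroup W G" and tors: "\<And>(p::int) n. Factorial_Ring.prime p \<Longrightarrow> tors (p ^ n) \<subseteq> W"
    and x: "x \<in> carrier G"
  shows "x \<in> W"
proof -
  have "x \<in> W" if "n > 0" "x \<in> tors (int n)" for n x
    using that
  proof (induction n arbitrary: x rule: less_induct)
    case (less n)
    note xc = tors_carrier[OF less.prems(2)]
    show ?case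
    proof (cases "n = 1")
      case True
      then have "x = \<one>" using less.prems xc by (simp add: tors_def)
      then show ?thesis using subgroup.one_closed[OF W] by simp
    next
      case False
      then obtain q where q: "Factorial_Ring.prime q" "q dvd n" using prime_factor_nat by blast
      have n0: "n \<noteq> 0" and nu: "\<not> is_unit q" using less.prems(1) q(1) not_prime_unit by auto
      obtain m where m: "n = q ^ multiplicity q n * m" "\<not> q dvd m" using multiplicity_decompose'[OF n0 nu] by blast
      let ?e = "multiplicity q n"
      have e: "?e > 0" using q n0 nu by (metis m mult_1 neq0_conv power_0)
      have cop: "coprime (int q ^ ?e) (int m)"
        using m(2) q(1) by (metis coprime_int_iff coprime_power_left_iff of_nat_power prime_imp_coprime)
      obtain a b where ab: "a * int q ^ ?e + b * int m = 1"
        using bezout_int[of "int q ^ ?e" "int m"] cop by (metis coprime_imp_gcd_eq_1)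
      have m0: "m > 0" using m(1) n0 by (metis mult_0_right not_gr0)
      have qe: "q ^ ?e > 1" using e q(1) by (meson one_less_power prime_gt_1_nat)
      have "m < n" using m(1) m0 qe by (metis mult_less_cancel2 nat_mult_1)
      moreover have "x [^] (int q ^ ?e) \<in> tors (int m)"
      proof -
        have "int q ^ ?e * int m = int n" using m(1) by (metis of_nat_mult of_nat_power)
        then show ?thesis using xc less.prems(2) by (simp add: tors_def int_pow_pow)
      qed
      ultimately have 1: "x [^] (int q ^ ?e) \<in> W" using less.IH m0 by blast
      have "x [^] int m \<in> tors (int q ^ ?e)"
      proof -
        have "int m * int q ^ ?e = int n" using m(1) by (metis mult.commute of_nat_mult of_nat_power)
        then show ?thesis using xc less.prems(2) by (simp add: tors_def int_pow_pow)
      qed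
      then have 2: "x [^] int m \<in> W" using tors[of "int q" ?e] q(1) by auto
      have "x = x [^] (int q ^ ?e * a + int m * b)" using ab xc by (simp add: mult.commute)
      also have "\<dots> = (x [^] (int q ^ ?e)) [^] a \<otimes> (x [^] int m) [^] b" using xc by (simp only: int_pow_mult int_pow_pow)
      also have "\<dots> \<in> W" using subgroup.m_closed[OF W subgroup_int_pow_closed[OF W 1] subgroup_int_pow_closed[OF W 2]] .
      finally show ?thesis .
    qed
  qed
  moreover obtain n :: nat where "n > 0" "x [^] n = \<one>" using torsion[OF x] by blast
  ultimately show ?thesis using x by (auto simp: tors_def int_pow_int)
qed

lemma prime_scalar_central:
  assumes u: "u \<in> hom G G" and \<delta>: "\<delta> \<in> hom G G"
    and sc: "\<And>(p::int) n. Factorial_Ring.prime p \<Longrightarrow> \<exists>k::int. \<forall>x\<in>tors (p ^ n). u x = x [^] k"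
    and x: "x \<in> carrier G"
  shows "u (\<delta> x) = \<delta> (u x)"
proof -
  define W where "W = {x \<in> carrier G. u (\<delta> x) = \<delta> (u x)}"
  have "subgroup W G"
  proof (rule subgroupI)
    show "W \<subseteq> carrier G" by (auto simp: W_def)
    have "\<one> \<in> W" using hom_one[OF u is_group is_group] hom_one[OF \<delta> is_group is_group] by (simp add: W_def)
    then show "W \<noteq> {}" by blast
    show "inv a \<in> W" if "a \<in> W" for a
      using that hom_in_carrier[OF u] hom_in_carrier[OF \<delta>] by (simp add: W_def hom_m_inv[OF u] hom_m_inv[OF \<delta>])
    show "a \<otimes> b \<in> W" if "a \<in> W" "b \<in> W" for a b
      using that hom_in_carrier[OF u] hom_in_carrier[OF \<delta>] by (simp add: W_def hom_mult[OF u] hom_mult[OF \<delta>])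
  qed
  moreover have "tors (p ^ n) \<subseteq> W" if p: "Factorial_Ring.prime p" for p :: int and n
  proof
    fix y assume y: "y \<in> tors (p ^ n)"
    obtain k :: int where k: "\<And>x. x \<in> tors (p ^ n) \<Longrightarrow> u x = x [^] k" using sc[OF p] by metis
    have "u (\<delta> y) = \<delta> (u y)" using k[OF y] k[OF hom_tors[OF \<delta> y]] hom_ipow[OF \<delta> tors_carrier[OF y]] by simp
    then show "y \<in> W" using tors_carrier[OF y] by (simp add: W_def)
  qed
  ultimately have "x \<in> W" using carrier_prime_power_generated x by blast
  then show ?thesis by (simp add: W_def)
qed

lemma finite_restrict_Union:
  assumes "finite P" "\<And>p. p \<in> P \<Longrightarrow> finite ((\<lambda>g. restrict g (E p)) ` \<Gamma>)"
  shows "finite ((\<lambda>g. restrict g (\<Union>p\<in>P. E p)) ` \<Gamma>)"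
proof (rule finite_image_factor)
  let ?\<Phi> = "\<lambda>g. \<lambda>p\<in>P. restrict g (E p)"
  have "?\<Phi> ` \<Gamma> \<subseteq> (\<Pi>\<^sub>E p\<in>P. (\<lambda>g. restrict g (E p)) ` \<Gamma>)" by auto
  moreover have "finite (\<Pi>\<^sub>E p\<in>P. (\<lambda>g. restrict g (E p)) ` \<Gamma>)" using assms by (intro finite_PiE)
  ultimately show "finite (?\<Phi> ` \<Gamma>)" by (rule finite_subset)
  fix g h assume eq: "?\<Phi> g = ?\<Phi> h"
  have "g x = h x" if "p \<in> P" "x \<in> E p" for p x
    using fun_cong[OF fun_cong[OF eq, of p], of x] that by simp
  then show "restrict g (\<Union>p\<in>P. E p) = restrict h (\<Union>p\<in>P. E p)" 
    by (intro restrict_ext) blast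
qed

lemma inertial_generate_central:
  assumes J: "finite J" "J \<subseteq> auto G" "\<And>\<gamma>. \<gamma> \<in> J \<Longrightarrow> inertial \<gamma>"
  obtains E where "finite ((\<lambda>g. restrict g E) ` generate (AutoGroup G) J)"
    "\<And>g h \<delta> x. \<lbrakk>g \<in> generate (AutoGroup G) J; h \<in> generate (AutoGroup G) J; restrict g E = restrict h E;
       \<delta> \<in> auto G; x \<in> carrier G\<rbrakk> \<Longrightarrow>
      (g \<otimes>\<^bsub>AutoGroup G\<^esub> inv\<^bsub>AutoGroup G\<^esub> h) (\<delta> x) = \<delta> ((g \<otimes>\<^bsub>AutoGroup G\<^esub> inv\<^bsub>AutoGroup G\<^esub> h) x)"
proof -
  interpret A: group "AutoGroup G" by (rule AutoGroup)
  let ?\<Gamma> = "generate (AutoGroup G) J"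
  have sub: "subgroup ?\<Gamma> (AutoGroup G)" using A.generate_is_subgroup J(2) by simp
  have \<Gamma>: "g \<in> auto G" if "g \<in> ?\<Gamma>" for g using subgroup.mem_carrier[OF sub that] by simp
  obtain P :: "int set" where P: "finite P"
    "\<And>p. \<lbrakk>Factorial_Ring.prime p; p \<notin> P\<rbrakk> \<Longrightarrow> prime_split p 0 (ppart p) \<and> (\<forall>\<gamma>\<in>J. scalar_on p (ppart p) \<gamma>)"
    using inertial_almost_all_primes[OF J(1,3)] by blast
  have "\<exists>N V. prime_split p N V \<and> (\<forall>\<gamma>\<in>J. scalar_on p V \<gamma>) \<and> (p \<notin> P \<longrightarrow> N = 0)" if "Factorial_Ring.prime p" for p :: int
    using inertial_prime_split[OF that J(1,3)] P(2)[OF that] by (cases "p \<in> P") blast+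
  then obtain N V where NV: "\<And>p::int. Factorial_Ring.prime p \<Longrightarrow> prime_split p (N p) (V p)"
    "\<And>p \<gamma>. \<lbrakk>Factorial_Ring.prime p; \<gamma> \<in> J\<rbrakk> \<Longrightarrow> scalar_on p (V p) \<gamma>" "\<And>p. \<lbrakk>Factorial_Ring.prime p; p \<notin> P\<rbrakk> \<Longrightarrow> N p = 0"
    by metis
  define Q where "Q = {p \<in> P. Factorial_Ring.prime p}"
  define E where "E = (\<Union>p\<in>Q. tors (p ^ N p))"
  have "finite ((\<lambda>g. restrict g E) ` ?\<Gamma>)"
    unfolding E_def using P(1) finite_restrict_tors[OF _ J] by (intro finite_restrict_Union) (auto simp: Q_def)
  moreover have "(g \<otimes>\<^bsub>AutoGroup G\<^esub> inv\<^bsub>AutoGroup G\<^esub> h) (\<delta> x) = \<delta> ((g \<otimes>\<^bsub>AutoGroup G\<^esub> inv\<^bsub>AutoGroup G\<^esub> h) x)"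
    if gh: "g \<in> ?\<Gamma>" "h \<in> ?\<Gamma>" "restrict g E = restrict h E" and \<delta>: "\<delta> \<in> auto G" and x: "x \<in> carrier G" for g h \<delta> x
  proof -
    let ?h = "inv\<^bsub>AutoGroup G\<^esub> h" and ?u = "g \<otimes>\<^bsub>AutoGroup G\<^esub> inv\<^bsub>AutoGroup G\<^esub> h"
    have h': "?h \<in> ?\<Gamma>" using subgroup.m_inv_closed[OF sub gh(2)] .
    have u: "?u \<in> ?\<Gamma>" using subgroup.m_closed[OF sub gh(1) h'] .
    note uhom = autoD(1)[OF \<Gamma>[OF u]]
    show ?thesis
    proof (rule prime_scalar_central[OF uhom autoD(1)[OF \<delta>] _ x])
      fix p :: int and n assume p: "Factorial_Ring.prime p"
      have "?u y = y" if y: "y \<in> tors (p ^ N p)" for y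
      proof (cases "p \<in> P")
        case True
        note yc = tors_carrier[OF y]
        have hy: "?h y \<in> tors (p ^ N p)" using hom_tors[OF autoD(1)[OF \<Gamma>[OF h']] y] .
        then have "?h y \<in> E" unfolding E_def Q_def using True p by blast
        then have "g (?h y) = h (?h y)" using fun_cong[OF gh(3), of "?h y"] by simp
        then show ?thesis using AutoGroup_mult[OF \<Gamma>[OF gh(1)] \<Gamma>[OF h'] yc] AutoGroup_inv[OF \<Gamma>[OF gh(2)] yc] by simp
      next
        case False
        then have "y [^] (1::int) = \<one>" using y NV(3)[OF p] by (simp add: tors_def)
        then have "y = \<one>" using tors_carrier[OF y] by simp
        then show ?thesis using hom_one[OF uhom is_group is_group] by simp
      qed
      then show "\<exists>k::int. \<forall>x\<in>tors (p ^ n). ?u x = x [^] k"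
        using prime_split_scalar[OF NV(1)[OF p] uhom] scalar_on_generate[OF p _ J(2) NV(2)[OF p] u] NV(1)[OF p]
        unfolding prime_split_def by blast
    qed
  qed
  ultimately show thesis by (rule that)
qed

lemma inertial_auto_imp_inertial:
  assumes "inertial_auto G \<gamma>"
  shows "inertial \<gamma>"
  unfolding inertial_def
proof (intro conjI allI impI)
  have auto: "\<gamma> \<in> auto G" using assms by (simp add: inertial_auto_def)
  show "\<gamma> \<in> hom G G" "inj_on \<gamma> (carrier G)" using autoD[OF auto] by auto
  fix H assume H: "subgroup H G"
  have "(\<lambda>x. H #> \<gamma> x) ` H \<subseteq> carrier (G\<lparr>carrier := H <#> \<gamma> ` H\<rparr> Mod H)"
  proof
    fix w assume "w \<in> (\<lambda>x. H #> \<gamma> x) ` H"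
    then obtain x where x: "x \<in> H" "w = H #> \<gamma> x" by blast
    have "\<one> \<otimes> \<gamma> x \<in> H <#> \<gamma> ` H" using x(1) by (intro set_multI[OF subgroup.one_closed[OF H]]) blast
    moreover have "\<gamma> x \<in> carrier G" using hom_in_carrier[OF autoD(1)[OF auto] subgroup.mem_carrier[OF H x(1)]] .
    ultimately have "\<gamma> x \<in> H <#> \<gamma> ` H" by simp
    then show "w \<in> carrier (G\<lparr>carrier := H <#> \<gamma> ` H\<rparr> Mod H)"
      using x(2) by (auto simp: FactGroup_def RCOSETS_def r_coset_def)
  qed
  moreover have "finite (carrier (G\<lparr>carrier := H <#> \<gamma> ` H\<rparr> Mod H))" using assms H by (simp add: inertial_auto_def)
  ultimately show "finite ((\<lambda>x. H #> \<gamma> x) ` H)" by (rule finite_subset)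
qed

end

section \<open>Centre and local finiteness\<close>

lemma (in group) generate_finitely_supported:
  assumes "x \<in> generate G S"
  shows "\<exists>J. finite J \<and> J \<subseteq> S \<and> x \<in> generate G J"
  using assms
proof (induction x rule: generate.induct)
  case one
  then show ?case using generate.one by (intro exI[of _ "{}"]) auto
next
  case (incl h)
  then show ?case using generate.incl[of h "{h}"] by (intro exI[of _ "{h}"]) auto
next
  case (inv h)
  then show ?case using generate.inv[of h "{h}"] by (intro exI[of _ "{h}"]) auto
next
  case (eng h1 h2)
  then obtain J1 J2 where J: "finite J1" "J1 \<subseteq> S" "h1 \<in> generate G J1" "finite J2" "J2 \<subseteq> S" "h2 \<in> generate G J2" by blast
  then have "h1 \<in> generate G (J1 \<union> J2)" "h2 \<in> generate G (J1 \<union> J2)"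
    using mono_generate[of J1 "J1 \<union> J2"] mono_generate[of J2 "J1 \<union> J2"] by auto
  then show ?case using J generate.eng by (intro exI[of _ "J1 \<union> J2"]) auto
qed

lemma (in group) generate_finitely_supported_set:
  assumes "finite T" "T \<subseteq> generate G S"
  shows "\<exists>J. finite J \<and> J \<subseteq> S \<and> T \<subseteq> generate G J"
proof -
  have "\<forall>x\<in>T. \<exists>J. finite J \<and> J \<subseteq> S \<and> x \<in> generate G J"
    using generate_finitely_supported[OF subsetD[OF assms(2)]] by (rule ballI)
  from bchoice[OF this] obtain f where f: "\<And>x. x \<in> T \<Longrightarrow> finite (f x) \<and> f x \<subseteq> S \<and> x \<in> generate G (f x)"
    by blast
  have "x \<in> generate G (\<Union>x\<in>T. f x)" if "x \<in> T" for x
    using mono_generate[of "f x" "\<Union>x\<in>T. f x"] f[OF that] that by blast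
  then show ?thesis using f assms(1) by (intro exI[of _ "\<Union>x\<in>T. f x"]) auto
qed

lemma (in group) subgroup_group_center: "subgroup (group_center G) G"
proof (rule subgroupI)
  show "group_center G \<subseteq> carrier G" by (auto simp: group_center_def)
  show "group_center G \<noteq> {}" by (auto simp: group_center_def intro!: exI[of _ \<one>])
  show "inv a \<in> group_center G" if a: "a \<in> group_center G" for a
    unfolding group_center_def
  proof (intro CollectI conjI ballI)
    have ac: "a \<in> carrier G" using a by (simp add: group_center_def)
    show "inv a \<in> carrier G" using ac by simp
    fix g assume g: "g \<in> carrier G"
    have "inv a \<otimes> g = inv a \<otimes> (g \<otimes> a) \<otimes> inv a" using ac g by (simp add: m_assoc)
    also have "g \<otimes> a = a \<otimes> g" using a g by (simp add: group_center_def)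
    also have "inv a \<otimes> (a \<otimes> g) \<otimes> inv a = g \<otimes> inv a" using ac g by (simp flip: m_assoc)
    finally show "inv a \<otimes> g = g \<otimes> inv a" .
  qed
  show "a \<otimes> b \<in> group_center G" if ab: "a \<in> group_center G" "b \<in> group_center G" for a b
    unfolding group_center_def
  proof (intro CollectI conjI ballI)
    have c: "a \<in> carrier G" "b \<in> carrier G" using ab by (auto simp: group_center_def)
    then show "a \<otimes> b \<in> carrier G" by simp
    fix g assume g: "g \<in> carrier G"
    have "a \<otimes> b \<otimes> g = a \<otimes> (b \<otimes> g)" using c g by (simp add: m_assoc)
    also have "b \<otimes> g = g \<otimes> b" using ab g by (simp add: group_center_def)
    also have "a \<otimes> (g \<otimes> b) = (a \<otimes> g) \<otimes> b" using c g by (simp add: m_assoc)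
    also have "a \<otimes> g = g \<otimes> a" using ab g by (simp add: group_center_def)
    finally show "a \<otimes> b \<otimes> g = g \<otimes> (a \<otimes> b)" using c g by (simp add: m_assoc)
  qed
qed

lemma (in group) normal_group_center: "group_center G \<lhd> G"
proof -
  have "x \<otimes> h \<otimes> inv x \<in> group_center G" if "x \<in> carrier G" "h \<in> group_center G" for x h
  proof -
    have hc: "h \<in> carrier G" "h \<otimes> x = x \<otimes> h" using that by (auto simp: group_center_def)
    have "x \<otimes> h \<otimes> inv x = h \<otimes> x \<otimes> inv x" by (simp only: hc(2))
    then have "x \<otimes> h \<otimes> inv x = h" using that(1) hc(1) by (simp add: m_assoc)
    then show ?thesis using that(2) by simp
  qed
  then show ?thesis using subgroup_group_center normal_inv_iff by blast
qed

theorem corollaryA: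
  fixes A :: "('a, 'b) monoid_scheme"
  assumes "comm_group A" and "periodic_group A"
  shows "\<exists>Z. subgroup Z (IAut A) \<and> Z \<subseteq> group_center (IAut A) \<and> locally_finite_group (IAut A Mod Z)"
proof -
  interpret T: torsion_comm_group A
    using assms by (simp add: torsion_comm_group_def torsion_comm_group_axioms_def periodic_group_def)
  let ?Aut = "AutoGroup A" and ?I = "IAut A"
  interpret Aut: group ?Aut by (rule T.AutoGroup)
  interpret I: group ?I unfolding IAut_def by (rule Aut.group_subgroup_generated)
  define S where "S = {\<gamma>. inertial_auto A \<gamma>}"
  have Sa: "S \<subseteq> auto A" by (auto simp: S_def inertial_auto_def)
  have Icar: "carrier ?I = generate ?Aut S"
    using Sa by (simp add: IAut_def carrier_subgroup_generated S_def Int_absorb1)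
  have Imult: "g \<otimes>\<^bsub>?I\<^esub> h = g \<otimes>\<^bsub>?Aut\<^esub> h" for g h by (simp add: IAut_def)
  have Iinv: "inv\<^bsub>?I\<^esub> g = inv\<^bsub>?Aut\<^esub> g" if "g \<in> carrier ?I" for g
    using that unfolding IAut_def by (rule Aut.inv_subgroup_generated)
  have Iauto: "g \<in> auto A" if "g \<in> carrier ?I" for g
    using that Aut.generate_in_carrier[of S g] Sa unfolding Icar by simp
  let ?Z = "group_center ?I"
  interpret Z: normal ?Z ?I by (rule I.normal_group_center)
  interpret Q: group "?I Mod ?Z" by (rule Z.factorgroup_is_group)
  have "finite (carrier (subgroup_generated (?I Mod ?Z) C))" if C: "finite C" "C \<subseteq> carrier (?I Mod ?Z)" for C
  proof -
    let ?\<phi> = "\<lambda>g. ?Z #>\<^bsub>?I\<^esub> g"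
    have "C \<subseteq> ?\<phi> ` carrier ?I" using C(2) by (auto simp: FactGroup_def RCOSETS_def)
    from finite_subset_image[OF C(1) this]
    obtain C0 where C0: "C0 \<subseteq> carrier ?I" "finite C0" "C = ?\<phi> ` C0" by blast
    obtain J where J: "finite J" "J \<subseteq> S" "C0 \<subseteq> generate ?Aut J"
      using Aut.generate_finitely_supported_set[OF C0(2) C0(1)[unfolded Icar]] by blast
    let ?\<Gamma> = "generate ?Aut J"
    have Ja: "J \<subseteq> auto A" using J(2) Sa by blast
    have Jin: "T.inertial \<gamma>" if "\<gamma> \<in> J" for \<gamma>
      by (rule T.inertial_auto_imp_inertial) (use that J(2) in \<open>auto simp: S_def\<close>)
    have \<Gamma>I: "?\<Gamma> \<subseteq> carrier ?I" unfolding Icar using Aut.mono_generate[OF J(2)] .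
    have \<Gamma>sub: "subgroup ?\<Gamma> ?I"
      using \<Gamma>I Aut.generate_is_subgroup[of J] Ja Aut.subgroup_subgroup_generated_iff unfolding IAut_def by auto
    interpret \<phi>: group_hom ?I "?I Mod ?Z" ?\<phi>
      using Z.r_coset_hom_Mod by unfold_locales
    have "C \<subseteq> ?\<phi> ` ?\<Gamma>" unfolding C0(3) using J(3) by (rule image_mono)
    then have "generate (?I Mod ?Z) C \<subseteq> ?\<phi> ` ?\<Gamma>"
      by (rule Q.generate_subgroup_incl[OF _ \<phi>.subgroup_img_is_subgroup[OF \<Gamma>sub]])
    moreover have "finite (?\<phi> ` ?\<Gamma>)"
    proof (rule T.inertial_generate_central[OF J(1) Ja Jin])
      fix E
      assume E: "finite ((\<lambda>g. restrict g E) ` ?\<Gamma>)"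
        and cen: "\<And>g h \<delta> x. \<lbrakk>g \<in> ?\<Gamma>; h \<in> ?\<Gamma>; restrict g E = restrict h E; \<delta> \<in> auto A; x \<in> carrier A\<rbrakk> \<Longrightarrow>
          (g \<otimes>\<^bsub>?Aut\<^esub> inv\<^bsub>?Aut\<^esub> h) (\<delta> x) = \<delta> ((g \<otimes>\<^bsub>?Aut\<^esub> inv\<^bsub>?Aut\<^esub> h) x)"
      show ?thesis
      proof (rule T.finite_image_factor[OF E])
        fix g h assume g: "g \<in> ?\<Gamma>" and h: "h \<in> ?\<Gamma>" and eq: "restrict g E = restrict h E"
        have c: "g \<in> carrier ?I" "h \<in> carrier ?I" using g h \<Gamma>I by auto
        define u where "u = g \<otimes>\<^bsub>?I\<^esub> inv\<^bsub>?I\<^esub> h"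
        have uI: "u \<in> carrier ?I" using c by (simp add: u_def)
        have u_eq: "u = g \<otimes>\<^bsub>?Aut\<^esub> inv\<^bsub>?Aut\<^esub> h" using Imult Iinv[OF c(2)] by (simp add: u_def)
        have "u \<otimes>\<^bsub>?I\<^esub> \<delta> = \<delta> \<otimes>\<^bsub>?I\<^esub> u" if \<delta>: "\<delta> \<in> carrier ?I" for \<delta>
        proof (rule extensionalityI)
          show "u \<otimes>\<^bsub>?I\<^esub> \<delta> \<in> extensional (carrier A)" "\<delta> \<otimes>\<^bsub>?I\<^esub> u \<in> extensional (carrier A)"
            using T.autoD(4)[OF Iauto] I.m_closed uI \<delta> by auto
          fix x assume x: "x \<in> carrier A"
          show "(u \<otimes>\<^bsub>?I\<^esub> \<delta>) x = (\<delta> \<otimes>\<^bsub>?I\<^esub> u) x"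
            using cen[OF g h eq Iauto[OF \<delta>] x] T.AutoGroup_mult[OF Iauto[OF uI] Iauto[OF \<delta>] x]
              T.AutoGroup_mult[OF Iauto[OF \<delta>] Iauto[OF uI] x] unfolding Imult u_eq[symmetric] by simp
        qed
        then have "u \<in> ?Z" unfolding group_center_def using uI by blast
        then have "?Z #>\<^bsub>?I\<^esub> u = ?Z" by (rule I.coset_join2[OF uI I.subgroup_group_center])
        then show "?\<phi> g = ?\<phi> h"
          unfolding u_def by (rule I.coset_mult_inv1[OF _ c Z.subset])
      qed
    qed
    ultimately show ?thesis
      using finite_subset[of "generate (?I Mod ?Z) C" "?\<phi> ` ?\<Gamma>"] Int_absorb1[OF C(2)]
      by (simp only: carrier_subgroup_generated)
  qed
  then have "locally_finite_group (?I Mod ?Z)" using Q.is_group by (simp add: locally_finite_group_def)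
  then show ?thesis using I.subgroup_group_center by (intro exI[of _ ?Z] conjI subset_refl)
qed

end
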